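(* Let $n,m$ be nonnegative integers with $n\ge m+1$. If $\varphi\in\mathcal{LP}_m$ and $\Phi:\mathbb{R}^{n-m}\to\mathbb{R}$ is a Schur-convex function, then $$\Phi\big(x_1(\varphi(D)[Q]),\ldots,x_{n-m}(\varphi(D)[Q])\big)\le\Phi\big(x_1(\varphi(D)[P]),\ldots,x_{n-m}(\varphi(D)[P])\big)$$ for all polynomials $P,Q\in\mathcal{H}_n$ such that $Q\preccurlyeq P$. In particular, the inequality $$\sum_{i=1}^{n-m}f\big(x_i(\varphi(D)[Q])\big)\le\sum_{i=1}^{n-m}f\big(x_i(\varphi(D)[P])\big)$$ holds for any convex function $f:\mathbb{R}\to\mathbb{R}$.
   Context: $\mathcal{H}_n$ denotes the set of monic univariate polynomials of degree $n$ all of whose zeros are real. For a polynomial $P$ of degree $d\ge1$, $x_1(P),\dots,x_d(P)$ denote its zeros counted with multiplicity. Spectral order: for real $n$-tuples $X=(x_1,\dots,x_n),Y=(y_1,\dots,y_n)$ write $X\prec Y$ if $\sum_{i=1}^n f(x_i)\le\sum_{i=1}^n f(y_i)$ for every convex $f:\mathbb{R}\to\mathbb{R}$ (equivalently, $X=AY$ as column vectors for some doubly stochastic matrix $A$). For $P,Q\in\mathcal{H}_n$ write $Q\preccurlyeq P$ if the tuple of zeros of $Q$ is $\prec$ the tuple of zeros of $P$. A function $\Phi:\mathbb{R}^d\to\mathbb{R}$ is Schur-convex if $\Phi(X)\le\Phi(Y)$ whenever $X\prec Y$. The Laguerre-Pólya class $\mathcal{LP}$ is the set of real entire functions of the form $\varphi(x)=cx^me^{-a^2x^2+bx}\prod_{k=1}^\infty(1-\alpha_kx)e^{\alpha_kx}$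 with $a,b,c,\alpha_k\in\mathbb{R}$, $c\ne0$, $m$ a nonnegative integer and $\sum_k\alpha_k^2<\infty$; $\mathcal{LP}_m$ is the set of $\varphi\in\mathcal{LP}$ having a zero of order exactly $m$ at $0$. With $D=d/dx$ and $\varphi(x)=\sum_k a_kx^k$, $\varphi(D)[P]=\sum_k a_kP^{(k)}$. (By a classical theorem of Pólya, for $P\in\mathcal{H}_n$ and $\varphi\in\mathcal{LP}_m$ the polynomial $\varphi(D)[P]$, of degree $n-m$, has only real zeros.) *)

theory Defs
  imports
    "HOL-Complex_Analysis.Complex_Analysis"
    "HOL-Computational_Algebra.Fundamental_Theorem_Algebra"
begin

section \<open>Real-rooted polynomials and their zeros\<close>

definition real_rooted :: "real poly \<Rightarrow> bool" where
  "real_rooted p \<longleftrightarrow> (\<forall>z::complex. poly (map_poly of_real p) z = 0 \<longrightarrow> z \<in> \<real>)"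

definition hyperbolic_polys :: "nat \<Rightarrow> real poly set" where
  "hyperbolic_polys n = {p. degree p = n \<and> lead_coeff p = 1 \<and> real_rooted p}"

text \<open>
  The list of real zeros, repeated according to multiplicity. For a nonzero real-rooted
  polynomial this is the full tuple of zeros (\<open>length_zeros\<close> below). The increasing order is
  only a choice of labelling: the notions below do not depend on it.
\<close>

definition zeros :: "real poly \<Rightarrow> real list" where
  "zeros p = sorted_list_of_multiset (proots p)"

lemma length_zeros:
  assumes "p \<noteq> 0" "real_rooted p"
  shows "length (zeros p) = degree p"
proof -
  have "size (proots p) = degree p"
    using assms
  proof (induction "degree p" arbitrary: p)
    case 0
    then show ?case
      by (metis le_zero_eq size_proots_le)
  next
    case (Suc d)
    have deg: "degree (map_poly of_real p :: complex poly) = degree p"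
      by (simp add: degree_map_poly)
    then have "\<not> constant (poly (map_poly of_real p :: complex poly))"
      using Suc.hyps(2) by (simp add: constant_degree)
    then obtain z :: complex where z: "poly (map_poly of_real p) z = 0"
      using fundamental_theorem_of_algebra by blast
    then have "z \<in> \<real>"
      using Suc.prems(2) by (auto simp: real_rooted_def)
    then obtain x where "z = of_real x"
      by (auto elim: Reals_cases)
    moreover have "poly (map_poly of_real p) (of_real x :: complex) = of_real (poly p x)"
      by (induction p) (auto simp: map_poly_pCons)
    ultimately have "poly p x = 0"
      using z by simp
    then obtain q where q: "p = [:-x, 1:] * q"
      by (auto simp: poly_eq_0_iff_dvd dvd_def)
    have q0: "q \<noteq> 0"
      using Suc.prems(1) q by auto
    have dq: "degree q = d"
      using Suc.hyps(2) q q0 by (simp add: degree_mult_eq del: mult_pCons_left)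
    have "map_poly of_real p = (map_poly of_real [:-x, 1:] * map_poly of_real q :: complex poly)"
      unfolding q by (rule poly_eqI) (simp add: coeff_map_poly coeff_mult del: mult_pCons_left)
    then have "real_rooted q"
      using Suc.prems(2) by (auto simp: real_rooted_def)
    then have "size (proots q) = d"
      using Suc.hyps(1)[of q] dq q0 by simp
    then show ?case
      using Suc.hyps(2) q q0 by (simp add: proots_mult del: mult_pCons_left)
  qed
  then show ?thesis
    by (metis zeros_def mset_sorted_list_of_multiset size_mset)
qed


section \<open>Spectral order and Schur-convexity\<close>

definition spectral_le :: "real list \<Rightarrow> real list \<Rightarrow> bool" (infix \<open>\<prec>\<close> 50) where
  "X \<prec> Y \<longleftrightarrow> length X = length Y \<and>
     (\<forall>f::real \<Rightarrow> real. convex_on UNIV f \<longrightarrow>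
        (\<Sum>i<length X. f (X ! i)) \<le> (\<Sum>i<length Y. f (Y ! i)))"

definition poly_spectral_le :: "real poly \<Rightarrow> real poly \<Rightarrow> bool" (infix \<open>\<preceq>\<close> 50) where
  "Q \<preceq> P \<longleftrightarrow> zeros Q \<prec> zeros P"

text \<open>A function on \<open>d\<close>-tuples is a function on lists, considered only at lists of length \<open>d\<close>.\<close>

definition schur_convex :: "nat \<Rightarrow> (real list \<Rightarrow> real) \<Rightarrow> bool" where
  "schur_convex d \<Phi> \<longleftrightarrow>
     (\<forall>X Y. length X = d \<longrightarrow> length Y = d \<longrightarrow> X \<prec> Y \<longrightarrow> \<Phi> X \<le> \<Phi> Y)"


section \<open>The Laguerre-Polya class and its differential operators\<close>

definition real_entire :: "(complex \<Rightarrow> complex) \<Rightarrow> bool" where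
  "real_entire \<phi> \<longleftrightarrow> \<phi> holomorphic_on UNIV \<and> (\<forall>x\<in>\<real>. \<phi> x \<in> \<real>)"

definition laguerre_polya :: "(complex \<Rightarrow> complex) set" where
  "laguerre_polya = {\<phi>. real_entire \<phi> \<and>
     (\<exists>(a::real) (b::real) (c::real) (m::nat) (\<alpha>::nat \<Rightarrow> real).
        c \<noteq> 0 \<and> summable (\<lambda>k. (\<alpha> k)\<^sup>2) \<and>
        (\<forall>z. \<phi> z = of_real c * z ^ m * exp (- (of_real a)\<^sup>2 * z\<^sup>2 + of_real b * z) *
               (\<Prod>k. (1 - of_real (\<alpha> k) * z) * exp (of_real (\<alpha> k) * z))))}"

definition laguerre_polya_ord :: "nat \<Rightarrow> (complex \<Rightarrow> complex) set" where
  "laguerre_polya_ord m = {\<phi> \<in> laguerre_polya. zorder \<phi> 0 = int m}"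

text \<open>The infinite product in the definition above always converges.\<close>

lemma convergent_prod_laguerre_polya:
  fixes \<alpha> :: "nat \<Rightarrow> real" and z :: complex
  assumes "summable (\<lambda>k. (\<alpha> k)\<^sup>2)"
  shows "convergent_prod (\<lambda>k. (1 - of_real (\<alpha> k) * z) * exp (of_real (\<alpha> k) * z))"
proof -
  have eq: "(1 - of_real (\<alpha> k) * z) * exp (of_real (\<alpha> k) * z) =
      weierstrass_factor 1 (of_real (\<alpha> k) * z)" for k
    by (simp add: weierstrass_factor_def)
  have "(\<lambda>k. (\<alpha> k)\<^sup>2) \<longlonglongrightarrow> 0"
    using assms by (rule summable_LIMSEQ_zero)
  then have "\<alpha> \<longlonglongrightarrow> 0"
    using tendsto_real_sqrt[of "\<lambda>k. (\<alpha> k)\<^sup>2" 0 sequentially]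
    by (simp add: tendsto_rabs_zero_iff)
  then have "(\<lambda>k. of_real (\<alpha> k) * z) \<longlonglongrightarrow> 0"
    by (auto intro!: tendsto_eq_intros)
  then have small: "eventually (\<lambda>k. norm (of_real (\<alpha> k) * z) < 1/2) sequentially"
    by (intro order_tendstoD(2)[OF tendsto_norm_zero]) auto
  have "summable (\<lambda>k. 3 * (norm z)\<^sup>2 * (\<alpha> k)\<^sup>2)"
    using assms by (rule summable_mult)
  then have "summable (\<lambda>k. norm (weierstrass_factor 1 (of_real (\<alpha> k) * z) - 1))"
  proof (rule summable_comparison_test_ev[rotated])
    show "eventually (\<lambda>k. norm (norm (weierstrass_factor 1 (of_real (\<alpha> k) * z) - 1))
        \<le> 3 * (norm z)\<^sup>2 * (\<alpha> k)\<^sup>2) sequentially"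
      using small
    proof eventually_elim
      case (elim k)
      then show ?case
        using weierstrass_factor_bound[of "of_real (\<alpha> k) * z" 1]
        by (simp add: norm_mult power2_eq_square mult_ac)
    qed
  qed
  then have "abs_convergent_prod (\<lambda>k. weierstrass_factor 1 (of_real (\<alpha> k) * z))"
    by (simp add: abs_convergent_prod_conv_summable)
  then show ?thesis
    unfolding eq by (rule abs_convergent_prod_imp_convergent_prod)
qed

text \<open>
  \<open>diff_op \<phi> p\<close> is \<open>\<phi>(D)[p]\<close>. The sum may stop at \<open>degree p\<close> since higher derivatives vanish.
  The Taylor coefficients of a real entire function are real (\<open>real_entire_fps_nth\<close> below),
  so \<open>Re\<close> only changes their type.
\<close>

definition diff_op :: "(complex \<Rightarrow> complex) \<Rightarrow> real poly \<Rightarrow> real poly" where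
  "diff_op \<phi> p = (\<Sum>k\<le>degree p. smult (Re (fps_nth (fps_expansion \<phi> 0) k)) ((pderiv ^^ k) p))"

lemma real_entire_deriv:
  assumes "real_entire \<phi>"
  shows "real_entire (deriv \<phi>)"
  unfolding real_entire_def
proof (intro conjI ballI)
  have hol: "\<phi> holomorphic_on UNIV" and re: "\<And>x. x \<in> \<real> \<Longrightarrow> \<phi> x \<in> \<real>"
    using assms by (auto simp: real_entire_def)
  show "deriv \<phi> holomorphic_on UNIV"
    using hol by (intro holomorphic_deriv) auto
  fix x :: complex
  assume x: "x \<in> \<real>"
  have "(\<phi> has_field_derivative deriv \<phi> x) (at x)"
    using hol by (auto intro: holomorphic_derivI)
  then have "((\<lambda>h. (\<phi> (x + h) - \<phi> x) / h) \<longlongrightarrow> deriv \<phi> x) (at 0)"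
    by (simp add: DERIV_def)
  moreover have "filterlim (\<lambda>n. of_real (1 / real (Suc n)) :: complex) (at 0) sequentially"
    unfolding filterlim_at
    using tendsto_of_real[OF LIMSEQ_inverse_real_of_nat, where ?'a = complex]
    by (auto simp: inverse_eq_divide simp del: of_nat_Suc)
  ultimately have "(\<lambda>n. (\<phi> (x + of_real (1 / real (Suc n))) - \<phi> x) / of_real (1 / real (Suc n)))
      \<longlonglongrightarrow> deriv \<phi> x"
    by (rule filterlim_compose)
  then show "deriv \<phi> x \<in> \<real>"
    using x by (intro Lim_in_closed_set[OF closed_complex_Reals])
      (auto intro!: always_eventually Reals_divide Reals_diff re Reals_add simp del: of_real_divide)
qed

lemma real_entire_fps_nth:
  assumes "real_entire \<phi>"
  shows "of_real (Re (fps_nth (fps_expansion \<phi> 0) k)) = fps_nth (fps_expansion \<phi> 0) k"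
proof -
  have "real_entire ((deriv ^^ k) \<phi>)"
    using assms by (induction k) (auto intro: real_entire_deriv)
  then have "(deriv ^^ k) \<phi> 0 / fact k \<in> \<real>"
    by (metis Reals_0 Reals_divide fact_in_Reals real_entire_def)
  then show ?thesis
    by (simp add: fps_expansion_def)
qed

end

theory Submission
  imports Defs "Jordan_Normal_Form.Determinant"
begin

text \<open>
  Every \<open>\<phi>(D)\<close> is, coefficient by coefficient, a limit of products of a constant, \<open>D\<close> and factors
  \<open>1 - \<alpha>D\<close>, and the spectral order is closed under such limits of real-rooted polynomials of fixed
  degree. So it suffices to treat \<open>P \<mapsto> \<gamma>P - P'\<close> (with \<open>\<gamma> = 0\<close> for \<open>D\<close>). For simple zeros
  \<open>x\<^sub>1, \<dots>, x\<^sub>n\<close> of \<open>P\<close>, the zeros \<open>y\<close> of the image are the solutions of \<open>\<Sum>\<^sub>i 1 / (y - x\<^sub>i) = \<gamma>\<close>, and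
  they are the eigenvalues of \<open>diag(x) + J / \<gamma>\<close>, where \<open>J\<close> is the all-ones matrix (for \<open>\<gamma> = 0\<close>: of the
  compression of \<open>diag(x)\<close> to the orthogonal complement of the constants), with eigenvectors
  \<open>(1 / (y - x\<^sub>i))\<^sub>i\<close>. Since \<open>J\<close> commutes with permutations, replacing \<open>x\<close> by a convex combination of \<open>x\<close>
  and a transposed copy of it replaces the matrix by the same convex combination of conjugates; its
  eigenvalues are then images of the old ones under a doubly stochastic matrix, and Jensen's
  inequality applies. By Muirhead's argument, finitely many such averagings of two entries connect
  any two tuples that are comparable in the spectral order.
\<close>

hide_const (open) Module.smult

section \<open>Majorization by averaging pairs\<close>

text \<open>Majorization in its Hardy-Littlewood-Polya form: equal sums, and convexity tested on
  hinge functions alone. The construction of transfers works with this form.\<close>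

definition hinge_le :: "real multiset \<Rightarrow> real multiset \<Rightarrow> bool" where
  "hinge_le A B \<longleftrightarrow> size A = size B \<and> \<Sum>\<^sub># A = \<Sum>\<^sub># B \<and>
     (\<forall>c. (\<Sum>x\<in>#A. max 0 (x - c)) \<le> (\<Sum>x\<in>#B. max 0 (x - c)))"

text \<open>Read from the more spread multiset to the less spread one. The sum condition places
  \<open>b'\<close> between \<open>a\<close> and \<open>b\<close> as well; either of
  \<open>a'\<close> and \<open>b'\<close> may be the larger.\<close>

inductive transfer :: "real multiset \<Rightarrow> real multiset \<Rightarrow> bool" where
  "a \<le> a' \<Longrightarrow> a' \<le> b \<Longrightarrow> a' + b' = a + b \<Longrightarrow>
     transfer (add_mset a (add_mset b R)) (add_mset a' (add_mset b' R))"

lemma transfer_add_mset: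
  assumes "transfer\<^sup>*\<^sup>* A B"
  shows "transfer\<^sup>*\<^sup>* (add_mset x A) (add_mset x B)"
  using assms
proof (induction rule: rtranclp_induct)
  case (step B C)
  from step(2) have "transfer (add_mset x B) (add_mset x C)"
  proof cases
    case (1 a a' b b' R)
    then show ?thesis
      using transfer.intros[of a a' b b' "add_mset x R"] by (simp add: add_mset_commute)
  qed
  with step(3) show ?case by simp
qed simp

lemma sum_mset_ge_size_mult:
  fixes R :: "'a multiset" and f :: "'a \<Rightarrow> real"
  assumes "\<And>x. x \<in># R \<Longrightarrow> c \<le> f x"
  shows "real (size R) * c \<le> (\<Sum>x\<in>#R. f x)"
  using assms by (induction R) (auto simp: algebra_simps intro: add_mono)

lemma sum_mset_le_size_mult:
  fixes R :: "'a multiset" and f :: "'a \<Rightarrow> real"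
  assumes "\<And>x. x \<in># R \<Longrightarrow> f x \<le> c"
  shows "(\<Sum>x\<in>#R. f x) \<le> real (size R) * c"
  using assms by (induction R) (auto simp: algebra_simps intro: add_mono)

lemma hinge_sum_filter:
  "(\<Sum>x\<in>#M. max 0 (x - c)) = (\<Sum>x\<in>#filter_mset (\<lambda>x. c < x) M. x - (c::real))"
  by (induction M) auto

lemma sum_mset_diff_const:
  "(\<Sum>x\<in>#M. x - c) = \<Sum>\<^sub># M - real (size M) * (c::real)"
  by (induction M) (auto simp: algebra_simps intro: add_mono)

lemma hinge_sum_ge_filter:
  assumes "c \<le> d"
  shows "(\<Sum>x\<in>#filter_mset (\<lambda>x. d < x) M. x - c) \<le> (\<Sum>x\<in>#M. max 0 (x - (c::real)))"
  using assms by (induction M) auto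

text \<open>This amounts to a transfer of the pair \<open>a\<close>, \<open>b\<close> to
  \<open>x\<close>, \<open>a + b - x\<close>, followed by cancelling \<open>x\<close>. For
  \<open>c \<le> a\<close> the inequality at \<open>c\<close> is the assumed one, and for
  \<open>c \<ge> x\<close> the left side vanishes. In between it is recovered by counting the
  entries above \<open>c\<close>, because \<open>R\<close> has none strictly between
  \<open>a\<close> and \<open>b\<close>.\<close>

lemma hinge_le_remove:
  assumes "hinge_le (add_mset x X) (add_mset a (add_mset b R))"
    and "\<And>y. y \<in># X \<Longrightarrow> y \<le> x" and "a \<le> x" and "x \<le> b"
    and "\<And>y. y \<in># R \<Longrightarrow> y \<le> a \<or> b \<le> y"
  shows "hinge_le X (add_mset (a + b - x) R)"
proof -
  let ?w = "a + b - x"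
  let ?h = "\<lambda>c x. max 0 (x - c) :: real"
  have hinge: "?h c x + (\<Sum>y\<in>#X. ?h c y) \<le> ?h c a + ?h c b + (\<Sum>y\<in>#R. ?h c y)" for c
    using assms(1) by (simp add: hinge_le_def add.assoc)
  have ha: "(\<Sum>y\<in>#X. ?h a y) \<le> ?w - a + (\<Sum>y\<in>#R. ?h a y)"
    using hinge[of a] assms(3,4) by simp
  have "(\<Sum>y\<in>#X. ?h c y) \<le> ?h c ?w + (\<Sum>y\<in>#R. ?h c y)" for c
  proof (cases "c \<le> a \<or> x \<le> c")
    case True
    then show ?thesis
    proof
      assume "c \<le> a"
      then show ?thesis using hinge[of c] assms(3,4) by simp
    next
      assume "x \<le> c"
      then have "\<And>y. y \<in># X \<Longrightarrow> ?h c y \<le> 0" using assms(2) by force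
      then have "(\<Sum>y\<in>#X. ?h c y) \<le> real (size X) * 0"
        by (rule sum_mset_le_size_mult)
      moreover have "0 \<le> (\<Sum>y\<in>#R. ?h c y)"
        using sum_mset_ge_size_mult[of R 0 "?h c"] by simp
      ultimately show ?thesis by simp
    qed
  next
    case False
    then have c: "a < c" "c < x" by auto
    define N where "N = filter_mset (\<lambda>y. c < y) X"
    define K where "K = filter_mset (\<lambda>y. c < y) R"
    have X: "(\<Sum>y\<in>#X. ?h c y) = \<Sum>\<^sub># N - real (size N) * c"
      by (simp add: N_def hinge_sum_filter sum_mset_diff_const)
    have R: "(\<Sum>y\<in>#R. ?h c y) = \<Sum>\<^sub># K - real (size K) * c"
      by (simp add: K_def hinge_sum_filter sum_mset_diff_const)
    \<comment> \<open>\<open>c\<close> lies in the gap of \<open>R\<close> between \<open>a\<close>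
      and \<open>b\<close>, so the entries of \<open>R\<close> above \<open>a\<close> are those
      above \<open>c\<close>.\<close>
    have "filter_mset (\<lambda>y. a < y) R = K"
      unfolding K_def using assms(4,5) c by (intro filter_mset_cong) force+
    then have Ra: "(\<Sum>y\<in>#R. ?h a y) = \<Sum>\<^sub># K - real (size K) * a"
      by (simp add: hinge_sum_filter sum_mset_diff_const)
    \<comment> \<open>If \<open>K\<close> has at least as many entries as \<open>N\<close>, compare
      through \<open>x\<close>: entries of \<open>N\<close> are at most \<open>x\<close>, entries of
      \<open>K\<close> at least \<open>x\<close>. Otherwise raising the hinge from \<open>a\<close>
      to \<open>c\<close> lowers the left side by \<open>size N * (c - a)\<close>, which is at least
      the \<open>(size K + 1) * (c - a)\<close> lost on the right, the \<open>+ 1\<close> standing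
      for the entry \<open>a + b - x\<close>.\<close>
    show ?thesis
    proof (cases "size N \<le> size K")
      case True
      have "\<Sum>\<^sub># N \<le> real (size N) * x"
        using sum_mset_le_size_mult[of N "\<lambda>y. y" x] assms(2) by (auto simp: N_def)
      moreover have "real (size K) * x \<le> \<Sum>\<^sub># K"
        using sum_mset_ge_size_mult[of K x "\<lambda>y. y"] assms(3-5) c by (force simp: K_def)
      moreover have "real (size N) * (x - c) \<le> real (size K) * (x - c)"
        using True c by (intro mult_right_mono) auto
      ultimately have "\<Sum>\<^sub># N - real (size N) * c \<le> \<Sum>\<^sub># K - real (size K) * c"
        by (simp add: algebra_simps)
      then show ?thesis unfolding X R by linarith
    next
      case False
      have "\<Sum>\<^sub># N - real (size N) * a \<le> (\<Sum>y\<in>#X. ?h a y)"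
        using hinge_sum_ge_filter[of a c X] c by (simp add: N_def sum_mset_diff_const)
      with ha Ra have "\<Sum>\<^sub># N - real (size N) * a \<le> ?w - a + \<Sum>\<^sub># K - real (size K) * a"
        by simp
      moreover have "(real (size K) + 1) * (c - a) \<le> real (size N) * (c - a)"
        using False c by (intro mult_right_mono) auto
      ultimately show ?thesis unfolding X R by (simp add: algebra_simps)
    qed
  qed
  then show ?thesis using assms(1) by (simp add: hinge_le_def)
qed

text \<open>The largest entry of \<open>X\<close> is created in \<open>Y\<close> by a transfer between its two neighbours there.\<close>

lemma hinge_le_imp_transfer:
  assumes "hinge_le X Y"
  shows "transfer\<^sup>*\<^sup>* Y X"
  using assms
proof (induction "size X" arbitrary: X Y)
  case 0
  then show ?case by (simp add: hinge_le_def)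
next
  case (Suc n)
  define x where "x = Max_mset X"
  have "X \<noteq> {#}" using Suc.hyps(2) by auto
  then have "x \<in># X" unfolding x_def by simp
  have max: "y \<le> x" if "y \<in># X" for y
    using that by (simp add: x_def)
  obtain X' where X: "X = add_mset x X'" using \<open>x \<in># X\<close> by (rule mset_add)
  have le: "y \<le> x" if "y \<in># X'" for y
    using that max[of y] by (simp add: X)
  have sz: "size X' = n" using Suc.hyps(2) X by simp
  have Yne: "size Y \<noteq> 0" using Suc.prems Suc.hyps(2) unfolding hinge_le_def by linarith
  have "\<exists>b\<in>#Y. x \<le> b"
  proof (rule ccontr)
    assume "\<not> ?thesis"
    then have *: "\<And>y. y \<in># Y \<Longrightarrow> y < x" by force
    \<comment> \<open>The hinge at the maximum of \<open>Y\<close> vanishes on all of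
      \<open>Y\<close>, whereas \<open>x\<close> alone makes its sum over \<open>X\<close>
      positive.\<close>
    define c where "c = Max_mset Y"
    have "c < x" unfolding c_def using Yne * by auto
    have "(\<Sum>y\<in>#Y. max 0 (y - c)) \<le> real (size Y) * 0"
      by (intro sum_mset_le_size_mult) (auto simp: c_def)
    moreover have "0 \<le> (\<Sum>y\<in>#X'. max 0 (y - c))"
      using sum_mset_ge_size_mult[of X' 0 "\<lambda>y. max 0 (y - c)"] by simp
    ultimately show False
      using Suc.prems \<open>c < x\<close> by (auto simp: hinge_le_def X dest: spec[of _ c])
  qed
  moreover have "\<exists>a\<in>#Y. a \<le> x"
  proof (rule ccontr)
    assume "\<not> ?thesis"
    then have *: "\<And>y. y \<in># Y \<Longrightarrow> x < y" by force
    obtain y Y' where Y: "Y = add_mset y Y'" using Yne by (cases Y) auto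
    have "real (size Y') * x \<le> \<Sum>\<^sub># Y'"
      using sum_mset_ge_size_mult[of Y' x "\<lambda>y. y"] * Y by (auto intro: less_imp_le)
    moreover have "\<Sum>\<^sub># X' \<le> real (size X') * x"
      using sum_mset_le_size_mult[of X' "\<lambda>y. y" x] le by auto
    ultimately show False
      using Suc.prems *[of y] unfolding hinge_le_def X Y by simp
  qed
  ultimately obtain a b0 where ab0: "a \<in># Y" "a \<le> x" "b0 \<in># Y" "x \<le> b0" by blast
  show ?case
  proof (cases "x \<in># Y")
    case True
    then obtain Y' where Y: "Y = add_mset x Y'" by (rule mset_add)
    have "hinge_le X' Y'" using Suc.prems by (simp add: hinge_le_def X Y)
    then show ?thesis using Suc.hyps(1)[of X' Y'] sz by (simp add: X Y transfer_add_mset)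
  next
    case False
    \<comment> \<open>The entries of \<open>Y\<close> closest to \<open>x\<close> on either side, so
      that the remaining ones leave the gap that \<open>hinge_le_remove\<close> requires.\<close>
    define a where "a = Max {y \<in> set_mset Y. y < x}"
    define b where "b = Min {y \<in> set_mset Y. x < y}"
    have "a \<in> {y \<in> set_mset Y. y < x}" unfolding a_def
      using ab0 False by (intro Max_in) (auto simp: order.order_iff_strict)
    then have a: "a \<in># Y" "a < x" by auto
    have "b \<in> {y \<in> set_mset Y. x < y}" unfolding b_def
      using ab0 False by (intro Min_in) (auto simp: order.order_iff_strict)
    then have b: "b \<in># Y" "x < b" by auto
    from a(1) obtain R' where R': "Y = add_mset a R'" by (rule mset_add)
    with a b have "b \<in># R'" by auto
    then obtain R where "R' = add_mset b R" by (rule mset_add)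
    with R' have Y: "Y = add_mset a (add_mset b R)" by simp
    have R: "y \<le> a \<or> b \<le> y" if "y \<in># R" for y
    proof -
      have "y \<in># Y" using that by (simp add: Y)
      then have "y \<noteq> x" using False by auto
      then show ?thesis
        using \<open>y \<in># Y\<close> unfolding a_def b_def by (cases "y < x") (auto intro!: Max_ge Min_le)
    qed
    have "hinge_le X' (add_mset (a + b - x) R)"
      using Suc.prems a b le R unfolding X Y by (intro hinge_le_remove) auto
    then have "transfer\<^sup>*\<^sup>* (add_mset (a + b - x) R) X'"
      using Suc.hyps(1) sz by blast
    then have "transfer\<^sup>*\<^sup>* (add_mset x (add_mset (a + b - x) R)) X"
      unfolding X by (rule transfer_add_mset)
    moreover have "transfer Y (add_mset x (add_mset (a + b - x) R))"
      unfolding Y using a b by (intro transfer.intros) auto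
    ultimately show ?thesis by (rule converse_rtranclp_into_rtranclp[rotated])
  qed
qed

section \<open>Eigenvalues of rank-one perturbations\<close>

definition orthonormal :: "nat \<Rightarrow> (nat \<Rightarrow> nat \<Rightarrow> real) \<Rightarrow> bool" where
  "orthonormal n U \<longleftrightarrow> (\<forall>j<n. \<forall>l<n. (\<Sum>i<n. U j i * U l i) = (if j = l then 1 else 0))"

lemma orthonormalD:
  "orthonormal n U \<Longrightarrow> j < n \<Longrightarrow> l < n \<Longrightarrow> (\<Sum>i<n. U j i * U l i) = (if j = l then 1 else 0)"
  by (simp add: orthonormal_def)

text \<open>A right inverse of a square matrix is also a left inverse, so orthonormality of the rows
  passes to the columns.\<close>

lemma orthonormal_transpose:
  assumes "orthonormal n U"
  shows "orthonormal n (\<lambda>i j. U j i)"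
proof -
  define A where "A = mat n n (\<lambda>(j, i). U j i)"
  define B where "B = mat n n (\<lambda>(i, j). U j i)"
  have "A * B = 1\<^sub>m n"
    using orthonormalD[OF assms]
    by (intro eq_matI) (auto simp: A_def B_def scalar_prod_def atLeast0LessThan)
  then have BA: "B * A = 1\<^sub>m n"
    by (intro mat_mult_left_right_inverse[of A]) (auto simp: A_def B_def)
  have "(\<Sum>l<n. U l i * U l j) = (B * A) $$ (i, j)" if "i < n" "j < n" for i j
    using that by (simp add: A_def B_def scalar_prod_def atLeast0LessThan)
  then show ?thesis
    unfolding orthonormal_def using BA by auto
qed

lemma orthonormal_expand:
  assumes "orthonormal n U" "i < n"
  shows "v i = (\<Sum>j<n. (\<Sum>l<n. U j l * v l) * U j i)"
proof -
  have "(\<Sum>j<n. (\<Sum>l<n. U j l * v l) * U j i) = (\<Sum>l<n. \<Sum>j<n. U j l * U j i * v l)"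
    by (subst sum.swap) (simp add: sum_distrib_right sum_distrib_left mult_ac)
  also have "\<dots> = (\<Sum>l<n. (if l = i then 1 else 0) * v l)"
    using orthonormalD[OF orthonormal_transpose[OF assms(1)]] assms(2)
    by (intro sum.cong refl) (simp flip: sum_distrib_right)
  also have "\<dots> = v i"
    using assms(2) by (simp add: if_distrib[of "\<lambda>x. x * _"] cong: if_cong)
  finally show ?thesis ..
qed

lemma orthonormal_parseval:
  assumes "orthonormal n U"
  shows "(\<Sum>j<n. (\<Sum>i<n. U j i * v i)\<^sup>2) = (\<Sum>i<n. (v i)\<^sup>2)"
proof -
  have "(\<Sum>i<n. (v i)\<^sup>2) = (\<Sum>i<n. v i * (\<Sum>j<n. (\<Sum>l<n. U j l * v l) * U j i))"
    using orthonormal_expand[OF assms] by (intro sum.cong) (auto simp: power2_eq_square)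
  also have "\<dots> = (\<Sum>j<n. \<Sum>i<n. (\<Sum>l<n. U j l * v l) * (U j i * v i))"
    by (subst sum.swap) (simp add: sum_distrib_left mult_ac)
  also have "\<dots> = (\<Sum>j<n. (\<Sum>i<n. U j i * v i)\<^sup>2)"
    by (simp add: power2_eq_square sum_distrib_left)
  finally show ?thesis ..
qed

text \<open>The bilinear form of the matrix \<open>diag(x) + \<alpha>J\<close>.\<close>

definition rank_one_form :: "nat \<Rightarrow> real \<Rightarrow> (nat \<Rightarrow> real) \<Rightarrow> (nat \<Rightarrow> real) \<Rightarrow> (nat \<Rightarrow> real) \<Rightarrow> real" where
  "rank_one_form n \<alpha> x u v = (\<Sum>i<n. x i * u i * v i) + \<alpha> * (\<Sum>i<n. u i) * (\<Sum>i<n. v i)"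

lemma rank_one_form_sum:
  "rank_one_form n \<alpha> x (\<lambda>i. \<Sum>j\<in>J. c j * U j i) v = (\<Sum>j\<in>J. c j * rank_one_form n \<alpha> x (U j) v)"
proof -
  have "(\<Sum>i<n. x i * (\<Sum>j\<in>J. c j * U j i) * v i) = (\<Sum>j\<in>J. c j * (\<Sum>i<n. x i * U j i * v i))"
    by (simp add: sum_distrib_left sum_distrib_right sum.swap[of _ _ J] mult_ac)
  moreover have "(\<Sum>i<n. \<Sum>j\<in>J. c j * U j i) = (\<Sum>j\<in>J. c j * (\<Sum>i<n. U j i))"
    by (simp add: sum_distrib_left sum.swap[of _ _ J])
  ultimately show ?thesis
    by (simp add: rank_one_form_def sum.distrib sum_distrib_left sum_distrib_right algebra_simps)
qed

lemma rank_one_form_commute: "rank_one_form n \<alpha> x u v = rank_one_form n \<alpha> x v u"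
  by (simp add: rank_one_form_def mult_ac)

lemma rank_one_form_cong:
  assumes "\<And>i. i < n \<Longrightarrow> u i = u' i"
  shows "rank_one_form n \<alpha> x u v = rank_one_form n \<alpha> x u' v"
  using assms by (simp add: rank_one_form_def)

text \<open>The spectral decomposition of the form on the span of the first \<open>d\<close> basis
  vectors: \<open>perp\<close> places \<open>v\<close> in that span, and the form is diagonal there.
  For \<open>d < n\<close> this describes the compression of the form to the span.\<close>

lemma rank_one_form_diagonal:
  assumes U: "orthonormal n U" and "d \<le> n"
    and diag: "\<And>j l. j < d \<Longrightarrow> l < d \<Longrightarrow> rank_one_form n \<alpha> x (U j) (U l) = (if j = l then \<mu> j else 0)"
    and perp: "\<And>j. d \<le> j \<Longrightarrow> j < n \<Longrightarrow> (\<Sum>i<n. U j i * v i) = 0"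
  shows "rank_one_form n \<alpha> x v v = (\<Sum>j<d. (\<Sum>i<n. U j i * v i)\<^sup>2 * \<mu> j)"
proof -
  define c where "c j = (\<Sum>i<n. U j i * v i)" for j
  define w where "w i = (\<Sum>j<d. c j * U j i)" for i
  have "v i = w i" if "i < n" for i
  proof -
    have "v i = (\<Sum>j<n. c j * U j i)" unfolding c_def by (rule orthonormal_expand[OF U that])
    also have "\<dots> = w i" unfolding w_def
      using \<open>d \<le> n\<close> perp by (intro sum.mono_neutral_right) (auto simp: c_def)
    finally show ?thesis .
  qed
  then have "rank_one_form n \<alpha> x v v = rank_one_form n \<alpha> x w w"
    using rank_one_form_cong[of n v w] rank_one_form_commute by metis
  also have "\<dots> = (\<Sum>j<d. c j * rank_one_form n \<alpha> x w (U j))"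
    unfolding w_def by (subst rank_one_form_sum) (metis rank_one_form_commute)
  also have "\<dots> = (\<Sum>j<d. c j * (\<Sum>l<d. c l * rank_one_form n \<alpha> x (U l) (U j)))"
    unfolding w_def by (subst rank_one_form_sum) simp
  also have "\<dots> = (\<Sum>j<d. c j * (c j * \<mu> j))"
  proof (intro sum.cong refl)
    fix j assume "j \<in> {..<d}"
    then have "(\<Sum>l<d. c l * rank_one_form n \<alpha> x (U l) (U j)) = (\<Sum>l<d. c l * (if l = j then \<mu> j else 0))"
      using diag by (intro sum.cong) auto
    also have "\<dots> = c j * \<mu> j" using \<open>j \<in> {..<d}\<close> by (simp add: if_distrib cong: if_cong)
    finally show "c j * (\<Sum>l<d. c l * rank_one_form n \<alpha> x (U l) (U j)) = c j * (c j * \<mu> j)" by simp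
  qed
  finally show ?thesis by (simp add: c_def power2_eq_square mult_ac)
qed

text \<open>Jensen's inequality is applied to each row; by the column sums every
  \<open>f (z j)\<close> is then collected with total weight 1.\<close>

lemma convex_sum_doubly_stochastic:
  fixes f :: "real \<Rightarrow> real"
  assumes "convex_on UNIV f"
    and "\<And>k j. k < d \<Longrightarrow> j < d \<Longrightarrow> 0 \<le> S k j"
    and row: "\<And>k. k < d \<Longrightarrow> (\<Sum>j<d. S k j) = 1" and col: "\<And>j. j < d \<Longrightarrow> (\<Sum>k<d. S k j) = 1"
    and "\<And>k. k < d \<Longrightarrow> y k = (\<Sum>j<d. S k j * z j)"
  shows "(\<Sum>k<d. f (y k)) \<le> (\<Sum>j<d. f (z j))"
proof -
  have "f (y k) \<le> (\<Sum>j<d. S k j * f (z j))" if "k < d" for k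
  proof -
    have "{..<d} \<noteq> {}" using that by auto
    then have "f (\<Sum>j<d. S k j *\<^sub>R z j) \<le> (\<Sum>j<d. S k j * f (z j))"
      using assms(1,2) row that by (intro convex_on_sum) auto
    then show ?thesis using assms(5) that by simp
  qed
  then have "(\<Sum>k<d. f (y k)) \<le> (\<Sum>k<d. \<Sum>j<d. S k j * f (z j))"
    by (intro sum_mono) auto
  also have "\<dots> = (\<Sum>j<d. (\<Sum>k<d. S k j) * f (z j))"
    by (subst sum.swap) (simp add: sum_distrib_right)
  finally show ?thesis using col by simp
qed

text \<open>The indices from \<open>d\<close> on carry common constant vectors; for \<open>d < n\<close> this encodes the compression to their complement.\<close>

lemma eigenvalues_pair_transfer:
  fixes f :: "real \<Rightarrow> real" and \<pi> :: "nat \<Rightarrow> nat"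
  assumes f: "convex_on UNIV f" and "d \<le> n" and \<theta>: "0 \<le> \<theta>" "\<theta> \<le> 1"
    and \<pi>: "bij_betw \<pi> {..<n} {..<n}" "\<And>i. i < n \<Longrightarrow> \<pi> (\<pi> i) = i"
    and x': "\<And>i. i < n \<Longrightarrow> x' i = (1 - \<theta>) * x i + \<theta> * x (\<pi> i)"
    and U: "orthonormal n U" and V: "orthonormal n V"
    and const: "\<And>j i. d \<le> j \<Longrightarrow> j < n \<Longrightarrow> U j i = u j \<and> V j i = u j"
    and diagU: "\<And>j l. j < d \<Longrightarrow> l < d \<Longrightarrow> rank_one_form n \<alpha> x (U j) (U l) = (if j = l then \<mu> j else 0)"
    and diagV: "\<And>k. k < d \<Longrightarrow> rank_one_form n \<alpha> x' (V k) (V k) = \<nu> k"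
  shows "(\<Sum>k<d. f (\<nu> k)) \<le> (\<Sum>j<d. f (\<mu> j))"
proof -
  define p where "p k j = (\<Sum>i<n. U j i * V k i)" for k j
  define q where "q k j = (\<Sum>i<n. U j i * V k (\<pi> i))" for k j
  \<comment> \<open>A mixture of two matrices of squared overlaps: those of the new eigenvectors
    \<open>V\<close> with \<open>U\<close>, and those with the copy of \<open>U\<close> permuted by
    \<open>\<pi>\<close>.\<close>
  define S where "S k j = (1 - \<theta>) * (p k j)\<^sup>2 + \<theta> * (q k j)\<^sup>2" for k j
  have reindex: "(\<Sum>i<n. g (\<pi> i)) = (\<Sum>i<n. g i)" for g :: "nat \<Rightarrow> real"
    using \<pi>(1) by (rule sum.reindex_bij_betw)
  have q': "q k j = (\<Sum>i<n. V k i * U j (\<pi> i))" for k j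
    unfolding q_def using \<pi>(2) by (subst reindex[symmetric]) (auto intro!: sum.cong)
  \<comment> \<open>The vectors from \<open>d\<close> on are constant, shared by both bases and
    fixed by \<open>\<pi>\<close>. They are therefore orthogonal to the first \<open>d\<close>
    vectors of either basis, and the \<open>d\<close> by \<open>d\<close> block of overlaps already
    has full row and column sums.\<close>
  have pU: "p k j = 0" "q k j = 0" if "k < d" "d \<le> j" "j < n" for k j
  proof -
    have "p k j = (\<Sum>i<n. V k i * V j i)" unfolding p_def using that const by (intro sum.cong) auto
    then show "p k j = 0" using orthonormalD[OF V] that \<open>d \<le> n\<close> by simp
    then show "q k j = 0" using const that \<open>d \<le> n\<close> by (simp add: q' p_def mult.commute)
  qed
  have pV: "p k j = 0" "q k j = 0" if "j < d" "d \<le> k" "k < n" for k j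
  proof -
    have "p k j = (\<Sum>i<n. U k i * U j i)" unfolding p_def using that const by (intro sum.cong) auto
    then show "p k j = 0" using orthonormalD[OF U] that \<open>d \<le> n\<close> by simp
    then show "q k j = 0" using const that \<open>d \<le> n\<close> by (simp add: q_def p_def)
  qed
  show ?thesis using f
  proof (rule convex_sum_doubly_stochastic[where S = S])
    show "0 \<le> S k j" for k j using \<theta> by (simp add: S_def)
  next
    fix k assume k: "k < d"
    have norm: "(\<Sum>i<n. (V k i)\<^sup>2) = 1"
      using orthonormalD[OF V, of k k] k \<open>d \<le> n\<close> by (simp add: power2_eq_square)
    have sum: "(\<Sum>j<d. g j) = (\<Sum>j<n. g j)" if "\<And>j. d \<le> j \<Longrightarrow> j < n \<Longrightarrow> g j = 0" for g :: "nat \<Rightarrow> real"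
      using that \<open>d \<le> n\<close> by (intro sum.mono_neutral_left) auto
    have "(\<Sum>j<d. (p k j)\<^sup>2) = 1" "(\<Sum>j<d. (q k j)\<^sup>2) = 1"
      using k pU orthonormal_parseval[OF U, of "V k"] orthonormal_parseval[OF U, of "\<lambda>i. V k (\<pi> i)"]
        norm reindex[of "\<lambda>i. (V k i)\<^sup>2"] by (simp_all add: sum p_def q_def)
    then show "(\<Sum>j<d. S k j) = 1"
      by (simp add: S_def sum.distrib flip: sum_distrib_left)
    let ?w = "\<lambda>i. V k (\<pi> i)"
    \<comment> \<open>The diagonal part is linear in the entries and the all-ones part is invariant
      under \<open>\<pi>\<close>, so permuting the entries has the same effect as permuting the
      vector.\<close>
    have "rank_one_form n \<alpha> x' (V k) (V k) =
        (1 - \<theta>) * rank_one_form n \<alpha> x (V k) (V k) + \<theta> * rank_one_form n \<alpha> x ?w ?w"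
    proof -
      have "(\<Sum>i<n. x i * ?w i * ?w i) = (\<Sum>i<n. x (\<pi> i) * V k i * V k i)"
        using \<pi>(2) by (subst reindex[symmetric]) (auto intro!: sum.cong)
      moreover have "(\<Sum>i<n. x' i * V k i * V k i) =
          (1 - \<theta>) * (\<Sum>i<n. x i * V k i * V k i) + \<theta> * (\<Sum>i<n. x (\<pi> i) * V k i * V k i)"
        unfolding sum_distrib_left sum.distrib[symmetric]
        by (intro sum.cong refl) (simp add: x' algebra_simps)
      ultimately show ?thesis
        by (simp add: rank_one_form_def reindex[of "V k"] algebra_simps)
    qed
    moreover have "rank_one_form n \<alpha> x (V k) (V k) = (\<Sum>j<d. (p k j)\<^sup>2 * \<mu> j)"
      unfolding p_def using pU(1) k by (intro rank_one_form_diagonal[OF U \<open>d \<le> n\<close> diagU]) (auto simp: p_def)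
    moreover have "rank_one_form n \<alpha> x ?w ?w = (\<Sum>j<d. (q k j)\<^sup>2 * \<mu> j)"
      unfolding q_def using pU(2) k by (intro rank_one_form_diagonal[OF U \<open>d \<le> n\<close> diagU]) (auto simp: q_def)
    ultimately show "\<nu> k = (\<Sum>j<d. S k j * \<mu> j)"
      using diagV[OF k] by (simp add: S_def distrib_right sum.distrib sum_distrib_left mult.assoc)
  next
    fix j assume j: "j < d"
    have norm: "(\<Sum>i<n. (U j i)\<^sup>2) = 1"
      using orthonormalD[OF U, of j j] j \<open>d \<le> n\<close> by (simp add: power2_eq_square)
    have sum: "(\<Sum>k<d. g k) = (\<Sum>k<n. g k)" if "\<And>k. d \<le> k \<Longrightarrow> k < n \<Longrightarrow> g k = 0" for g :: "nat \<Rightarrow> real"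
      using that \<open>d \<le> n\<close> by (intro sum.mono_neutral_left) auto
    have "(\<Sum>k<n. (p k j)\<^sup>2) = 1"
      using orthonormal_parseval[OF V, of "U j"] norm by (simp add: p_def mult.commute)
    moreover have "(\<Sum>k<n. (q k j)\<^sup>2) = 1"
      using orthonormal_parseval[OF V, of "\<lambda>i. U j (\<pi> i)"] norm reindex[of "\<lambda>i. (U j i)\<^sup>2"]
      by (simp add: q')
    ultimately have "(\<Sum>k<d. (p k j)\<^sup>2) = 1" "(\<Sum>k<d. (q k j)\<^sup>2) = 1"
      using j pV by (simp_all add: sum)
    then show "(\<Sum>k<d. S k j) = 1"
      by (simp add: S_def sum.distrib flip: sum_distrib_left)
  qed
qed

section \<open>Zeros of linear differential operators\<close>

definition root_poly :: "real multiset \<Rightarrow> real poly" where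
  "root_poly M = (\<Prod>x\<in>#M. [:- x, 1:])"

lemma root_poly_simps [simp]:
  "root_poly {#} = 1" "root_poly (add_mset x M) = [:- x, 1:] * root_poly M"
  by (simp_all add: root_poly_def)

lemma root_poly_nonzero [simp]: "root_poly M \<noteq> 0"
  by (induction M) (auto simp del: mult_pCons_left)

lemma degree_root_poly [simp]: "degree (root_poly M) = size M"
  by (induction M) (simp_all add: degree_mult_eq del: mult_pCons_left)

lemma proots_root_poly [simp]: "proots (root_poly M) = M"
  by (induction M) (simp_all add: proots_mult del: mult_pCons_left)

lemma poly_root_poly: "poly (root_poly M) t = (\<Prod>x\<in>#M. t - x)"
  by (induction M) (simp_all add: algebra_simps)

lemma eq_smult_root_poly:
  assumes "p \<noteq> 0" "size (proots p) = degree p"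
  shows "p = smult (lead_coeff p) (root_poly (proots p))"
  using assms
proof (induction "degree p" arbitrary: p)
  case 0
  then have "proots p = {#}" by simp
  moreover obtain c where "p = [:c:]" using 0 degree_eq_zeroE by metis
  ultimately show ?case using 0 by simp
next
  case (Suc n)
  then have "proots p \<noteq> {#}" by auto
  then obtain x where "x \<in># proots p" by blast
  then have "poly p x = 0" using Suc.prems by simp
  then obtain q where p: "p = [:- x, 1:] * q"
    by (auto simp: poly_eq_0_iff_dvd dvd_def)
  have q: "q \<noteq> 0" using Suc.prems p by auto
  have deg: "degree p = Suc (degree q)"
    using q unfolding p by (simp add: degree_mult_eq del: mult_pCons_left)
  have pr: "proots p = add_mset x (proots q)"
    using q unfolding p by (simp add: proots_mult del: mult_pCons_left)
  have lc: "lead_coeff p = lead_coeff q"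
    unfolding p lead_coeff_mult by simp
  have "q = smult (lead_coeff q) (root_poly (proots q))"
    using Suc deg pr q by simp
  then have "p = [:- x, 1:] * smult (lead_coeff q) (root_poly (proots q))"
    using p by simp
  then show ?case unfolding lc pr by (simp del: mult_pCons_left)
qed

section \<open>Real polynomials evaluated over larger fields\<close>

lemma map_poly_of_real_mult:
  "map_poly of_real (p * q) = (map_poly of_real p * map_poly of_real q :: 'a::real_field poly)"
  by (rule poly_eqI) (simp add: coeff_map_poly coeff_mult)

lemma map_poly_of_real_add:
  "map_poly of_real (p + q) = (map_poly of_real p + map_poly of_real q :: 'a::real_field poly)"
  by (rule poly_eqI) (simp add: coeff_map_poly)

lemma map_poly_of_real_diff:
  "map_poly of_real (p - q) = (map_poly of_real p - map_poly of_real q :: 'a::real_field poly)"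
  by (rule poly_eqI) (simp add: coeff_map_poly)

lemma map_poly_of_real_smult:
  "map_poly of_real (smult c p) = (smult (of_real c) (map_poly of_real p) :: 'a::real_field poly)"
  by (rule poly_eqI) (simp add: coeff_map_poly)

lemma poly_of_real_root_poly:
  "poly (map_poly of_real (root_poly M)) (z :: 'a::real_field) = (\<Prod>x\<in>#M. z - of_real x)"
proof (induction M)
  case (add x M)
  then show ?case
    unfolding root_poly_simps map_poly_of_real_mult poly_mult by (simp add: map_poly_pCons)
qed simp

lemma real_rooted_root_poly: "real_rooted (root_poly M)"
  by (auto simp: real_rooted_def poly_of_real_root_poly prod_mset_zero_iff)

lemma real_rooted_smult [simp]: "c \<noteq> 0 \<Longrightarrow> real_rooted (smult c p) \<longleftrightarrow> real_rooted p"
  by (simp add: real_rooted_def map_poly_of_real_smult)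

lemma mset_zeros: "mset (zeros p) = proots p"
  by (simp add: zeros_def)

lemma real_rooted_size_proots: "p \<noteq> 0 \<Longrightarrow> real_rooted p \<Longrightarrow> size (proots p) = degree p"
  by (metis length_zeros mset_zeros size_mset)

lemma real_rooted_eq_root_poly:
  "p \<noteq> 0 \<Longrightarrow> real_rooted p \<Longrightarrow> p = smult (lead_coeff p) (root_poly (proots p))"
  by (simp add: eq_smult_root_poly real_rooted_size_proots)

text \<open>The logarithmic derivative of a product of linear factors. The general field allows
  complex points, for real-rootedness, and real points, for locating zeros.\<close>

lemma poly_pderiv_root_poly:
  fixes z :: "'a::real_field"
  assumes "\<And>x. x \<in># M \<Longrightarrow> z \<noteq> of_real x"
  shows "poly (map_poly of_real (pderiv (root_poly M))) z =
    poly (map_poly of_real (root_poly M)) z * (\<Sum>x\<in>#M. 1 / (z - of_real x))"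
  using assms
proof (induction M)
  case (add x M)
  then have nz: "z - of_real x \<noteq> 0" by simp
  have 1: "poly (map_poly of_real (pderiv (root_poly (add_mset x M)))) z =
      poly (map_poly of_real (root_poly M)) z + (z - of_real x) * poly (map_poly of_real (pderiv (root_poly M))) z"
    unfolding root_poly_simps pderiv_mult map_poly_of_real_mult map_poly_of_real_add poly_mult poly_add
    by (simp add: pderiv_pCons map_poly_pCons)
  have 2: "poly (map_poly of_real (root_poly (add_mset x M))) z =
      (z - of_real x) * poly (map_poly of_real (root_poly M)) z"
    by (simp add: poly_of_real_root_poly del: root_poly_simps(2))
  have 3: "poly (map_poly of_real (pderiv (root_poly M))) z =
      poly (map_poly of_real (root_poly M)) z * (\<Sum>x\<in>#M. 1 / (z - of_real x))"
    using add by simp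
  show ?case unfolding 1 2 3 using nz by (simp add: distrib_left mult_ac)
qed simp

text \<open>Up to a nonzero constant factor this covers both \<open>D\<close> (at
  \<open>\<gamma> = 0\<close>) and \<open>1 - \<alpha>D\<close> with nonzero \<open>\<alpha>\<close>
  (at \<open>\<gamma> = 1 / \<alpha>\<close>), so one argument serves for both.\<close>

definition linear_op :: "real \<Rightarrow> real poly \<Rightarrow> real poly" where
  "linear_op \<gamma> p = smult \<gamma> p - pderiv p"

lemma linear_op_smult: "linear_op \<gamma> (smult c p) = smult c (linear_op \<gamma> p)"
  by (simp add: linear_op_def pderiv_smult smult_diff_right mult.commute)

lemma poly_linear_op_root_poly:
  fixes z :: "'a::real_field"
  assumes "\<And>x. x \<in># M \<Longrightarrow> z \<noteq> of_real x"
  shows "poly (map_poly of_real (linear_op \<gamma> (root_poly M))) z =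
    poly (map_poly of_real (root_poly M)) z * (of_real \<gamma> - (\<Sum>x\<in>#M. 1 / (z - of_real x)))"
  using poly_pderiv_root_poly[OF assms]
  by (simp add: linear_op_def map_poly_of_real_diff map_poly_of_real_smult algebra_simps)

definition linear_deg :: "real \<Rightarrow> nat \<Rightarrow> nat" where
  "linear_deg \<gamma> n = (if \<gamma> = 0 then n - 1 else n)"

lemma linear_op_degree:
  assumes "p \<noteq> 0" "\<gamma> \<noteq> 0 \<or> degree p \<noteq> 0"
  shows "linear_op \<gamma> p \<noteq> 0 \<and> degree (linear_op \<gamma> p) = linear_deg \<gamma> (degree p)"
proof (cases "\<gamma> = 0")
  case True
  then show ?thesis using assms
    by (auto simp: linear_op_def linear_deg_def degree_pderiv pderiv_eq_0_iff)
next
  case False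
  have "coeff (linear_op \<gamma> p) (degree p) = \<gamma> * lead_coeff p"
    by (simp add: linear_op_def coeff_pderiv coeff_eq_0)
  then have "coeff (linear_op \<gamma> p) (degree p) \<noteq> 0" using False assms by simp
  moreover have "degree (linear_op \<gamma> p) \<le> degree p"
    unfolding linear_op_def
    by (intro degree_diff_le) (auto simp: degree_pderiv)
  ultimately show ?thesis
    using False le_degree[of "linear_op \<gamma> p" "degree p"] by (auto simp: linear_deg_def)
qed

text \<open>The imaginary parts of the summands are negative multiples of \<open>Im z\<close>, so
  they all have the same sign and cannot cancel.\<close>

lemma Im_sum_inverse_nonzero:
  assumes "Im z \<noteq> 0" "M \<noteq> {#}"
  shows "Im (\<Sum>x\<in>#M. 1 / (z - of_real x)) \<noteq> 0"
proof -
  have nz: "z \<noteq> of_real x" for x using assms(1) by auto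
  have "Im (\<Sum>x\<in>#M. 1 / (z - of_real x)) = - Im z * (\<Sum>x\<in>#M. 1 / (cmod (z - of_real x))\<^sup>2)"
    by (induction M) (simp_all add: Im_divide cmod_power2 algebra_simps)
  moreover have "0 < (\<Sum>x\<in>#M. 1 / (cmod (z - of_real x))\<^sup>2)"
    using assms(2)
  proof (induction M)
    case (add x M)
    have "0 < 1 / (cmod (z - of_real x))\<^sup>2" using nz by simp
    then show ?case using add by (cases "M = {#}") (auto intro: add_pos_pos)
  qed simp
  ultimately show ?thesis
    by (metis assms(1) less_irrefl mult_eq_0_iff neg_equal_0_iff_equal)
qed

text \<open>At a nonreal zero the logarithmic derivative would equal the real number
  \<open>\<gamma>\<close>, although its imaginary part is nonzero. For constant \<open>p\<close> it
  is an empty sum, which would force \<open>\<gamma> = 0\<close>.\<close>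

lemma real_rooted_linear_op:
  assumes "p \<noteq> 0" "real_rooted p" "\<gamma> \<noteq> 0 \<or> degree p \<noteq> 0"
  shows "real_rooted (linear_op \<gamma> p)"
proof -
  define M where "M = proots p"
  have p: "p = smult (lead_coeff p) (root_poly M)"
    unfolding M_def by (rule real_rooted_eq_root_poly) fact+
  have "real_rooted (linear_op \<gamma> (root_poly M))"
    unfolding real_rooted_def
  proof (intro allI impI, rule ccontr)
    fix z :: complex
    assume z: "poly (map_poly of_real (linear_op \<gamma> (root_poly M))) z = 0" "z \<notin> \<real>"
    then have nz: "z \<noteq> of_real x" for x by auto
    have "Im z \<noteq> 0" using z(2) by (simp add: complex_is_Real_iff)
    have "poly (map_poly of_real (root_poly M)) z \<noteq> 0"
      using nz by (auto simp: poly_of_real_root_poly prod_mset_zero_iff)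
    then have eq: "of_real \<gamma> = (\<Sum>x\<in>#M. 1 / (z - of_real x))"
      using z(1) nz by (simp add: poly_linear_op_root_poly)
    show False
    proof (cases "M = {#}")
      case True
      then show False using eq assms(3) real_rooted_size_proots[OF assms(1,2)] by (auto simp: M_def)
    next
      case False
      then show False using Im_sum_inverse_nonzero[OF \<open>Im z \<noteq> 0\<close> False] unfolding eq[symmetric] by simp
    qed
  qed
  then show ?thesis
    using assms(1) by (subst p) (simp add: linear_op_smult)
qed

text \<open>At a simple zero of \<open>P\<close> the image takes the value \<open>- P'\<close>,
  which is nonzero. Hence the zeros of the image avoid all \<open>x i\<close> and solve the secular
  equation. At such a zero \<open>t\<close> the derivative of the image is \<open>P(t)\<close> times
  the positive sum of \<open>1 / (t - x i)^2\<close>, so the zero is simple.\<close>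

lemma linear_op_simple_roots:
  fixes x :: "nat \<Rightarrow> real"
  assumes inj: "inj_on x {..<n}" and n: "\<gamma> \<noteq> 0 \<or> n \<noteq> 0"
  defines "q \<equiv> linear_op \<gamma> (root_poly (image_mset x (mset_set {..<n})))"
  obtains y where "inj_on y {..<linear_deg \<gamma> n}"
    "proots q = image_mset y (mset_set {..<linear_deg \<gamma> n})"
    "\<And>k i. k < linear_deg \<gamma> n \<Longrightarrow> i < n \<Longrightarrow> y k \<noteq> x i"
    "\<And>k. k < linear_deg \<gamma> n \<Longrightarrow> (\<Sum>i<n. 1 / (y k - x i)) = \<gamma>"
proof -
  define M where "M = image_mset x (mset_set {..<n})"
  define P where "P = root_poly M"
  define d where "d = linear_deg \<gamma> n"
  have sizeM: "size M = n" by (simp add: M_def)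
  have Mx: "t \<in># M \<longleftrightarrow> (\<exists>i<n. t = x i)" for t by (auto simp: M_def)
  have q: "q = linear_op \<gamma> P" by (simp add: q_def P_def M_def)
  have q0: "q \<noteq> 0" and deg: "degree q = d" and "real_rooted q"
    using linear_op_degree[of P \<gamma>] real_rooted_linear_op[of P \<gamma>] n real_rooted_root_poly
    by (auto simp: q P_def sizeM d_def)
  then have size: "size (proots q) = d" by (simp add: real_rooted_size_proots)
  have id: "map_poly of_real p = p" for p :: "real poly"
    by (simp add: map_poly_def flip: coeffs_def)
  have qt: "poly q t = poly P t * (\<gamma> - (\<Sum>i<n. 1 / (t - x i)))" if "\<And>i. i < n \<Longrightarrow> t \<noteq> x i" for t
  proof -
    have "s \<in># M \<Longrightarrow> t \<noteq> of_real s" for s using that by (auto simp: Mx)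
    from poly_linear_op_root_poly[of M t \<gamma>, OF this]
    have "poly q t = poly P t * (\<gamma> - (\<Sum>s\<in>#M. 1 / (t - s)))" by (simp add: q P_def id)
    then show ?thesis by (simp add: M_def sum_unfold_sum_mset image_mset.compositionality comp_def)
  qed
  have nroot: "t \<noteq> x i" if "poly q t = 0" "i < n" for t i
  proof
    assume "t = x i"
    with that have "t \<in># M" by (auto simp: Mx)
    then obtain R where R: "M = add_mset t R" by (rule mset_add)
    have "count M t = 1"
    proof -
      have "count M t = (\<Sum>j | j < n \<and> x j = x i. 1)"
        by (simp add: M_def count_image_mset \<open>t = x i\<close> vimage_def Int_def conj_commute)
      also have "{j. j < n \<and> x j = x i} = {i}" using inj that by (auto dest: inj_onD)
      finally show ?thesis by simp
    qed
    then have "t \<notin># R" by (simp add: R not_in_iff)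
    then have "poly (root_poly R) t \<noteq> 0" by (auto simp: poly_root_poly prod_mset_zero_iff)
    moreover have "poly q t = - poly (root_poly R) t"
      by (simp add: q P_def R linear_op_def pderiv_mult pderiv_pCons del: mult_pCons_left)
    ultimately show False using that by simp
  qed
  have P0: "poly P t \<noteq> 0" if "\<And>i. i < n \<Longrightarrow> t \<noteq> x i" for t
  proof
    assume "poly P t = 0"
    then obtain s where "s \<in># M" "t - s = 0" by (auto simp: P_def poly_root_poly prod_mset_zero_iff)
    then show False using that Mx by auto
  qed
  have sumq: "(\<Sum>i<n. 1 / (t - x i)) = \<gamma>" if "poly q t = 0" for t
  proof -
    show ?thesis using qt[of t] P0[of t] nroot[OF that] that by auto
  qed
  have "poly (pderiv q) t \<noteq> 0" if "poly q t = 0" for t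
  proof -
    note nr = nroot[OF that]
    have "n \<noteq> 0" using sumq[OF that] n by (cases n) auto
    \<comment> \<open>The factored formula for \<open>q\<close> holds only away from the poles
      \<open>x i\<close>; on this open set it may be differentiated in place of
      \<open>q\<close>.\<close>
    define A where "A = - x ` {..<n}"
    have "open A" unfolding A_def by (intro open_Compl finite_imp_closed) auto
    have "t \<in> A" using nr unfolding A_def by blast
    have "((\<lambda>t. poly P t * (\<gamma> - (\<Sum>i<n. 1 / (t - x i)))) has_field_derivative
        poly (pderiv P) t * (\<gamma> - (\<Sum>i<n. 1 / (t - x i))) + poly P t * (\<Sum>i<n. 1 / (t - x i)\<^sup>2)) (at t)"
      using nr by (auto intro!: derivative_eq_intros simp: power2_eq_square sum_negf)
    then have "(poly q has_field_derivative
        poly (pderiv P) t * (\<gamma> - (\<Sum>i<n. 1 / (t - x i))) + poly P t * (\<Sum>i<n. 1 / (t - x i)\<^sup>2)) (at t)"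
    proof (rule has_field_derivative_transform_within_open[OF _ \<open>open A\<close> \<open>t \<in> A\<close>])
      fix s assume "s \<in> A"
      then have "s \<noteq> x i" if "i < n" for i using that unfolding A_def by blast
      then show "poly P s * (\<gamma> - (\<Sum>i<n. 1 / (s - x i))) = poly q s" by (rule qt[symmetric])
    qed
    from DERIV_unique[OF poly_DERIV this]
    have "poly (pderiv q) t = poly P t * (\<Sum>i<n. 1 / (t - x i)\<^sup>2)"
      using sumq[OF that] by simp
    moreover have "poly P t \<noteq> 0" using nr by (rule P0)
    moreover have "0 < (\<Sum>i<n. 1 / (t - x i)\<^sup>2)"
      using nr \<open>n \<noteq> 0\<close> by (intro sum_pos) auto
    ultimately show ?thesis by simp
  qed
  then have "rsquarefree q" by (simp add: rsquarefree_roots)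
  have pr: "proots q = mset_set {t. poly q t = 0}"
  proof (rule multiset_eqI)
    fix t
    have fin: "finite {t. poly q t = 0}" using q0 by (rule poly_roots_finite)
    have "order t q = 0 \<or> order t q = 1" using \<open>rsquarefree q\<close> by (simp add: rsquarefree_def)
    then have "order t q = (if poly q t = 0 then 1 else 0)"
      using q0 by (elim disjE) (simp_all add: order_root)
    then show "count (proots q) t = count (mset_set {t. poly q t = 0}) t"
      using q0 fin by (simp add: count_mset_set')
  qed
  then have "card {t. poly q t = 0} = d" using size by simp
  then obtain y where y: "bij_betw y {..<d} {t. poly q t = 0}"
    using ex_bij_betw_nat_finite[OF poly_roots_finite[OF q0]] by (auto simp: atLeast0LessThan)
  then have root: "poly q (y k) = 0" if "k < d" for k
    using that by (auto simp: bij_betw_def)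
  show thesis
  proof (rule that[of y, folded d_def])
    show "inj_on y {..<d}" using y by (simp add: bij_betw_def)
    then show "proots q = image_mset y (mset_set {..<d})"
      using y pr by (simp add: image_mset_mset_set bij_betw_def)
  qed (use nroot sumq root in auto)
qed

text \<open>Normalised eigenvectors at the zeros \<open>y j\<close>. The second branch is the
  constant unit vector; it is needed below \<open>n\<close> only for \<open>\<gamma> = 0\<close>,
  where it completes the \<open>n - 1\<close> eigenvectors to a basis.\<close>

definition root_vectors :: "nat \<Rightarrow> nat \<Rightarrow> (nat \<Rightarrow> real) \<Rightarrow> (nat \<Rightarrow> real) \<Rightarrow> nat \<Rightarrow> nat \<Rightarrow> real" where
  "root_vectors n d x y j i =
     (if j < d then 1 / (y j - x i) / sqrt (\<Sum>l<n. 1 / (y j - x l)\<^sup>2) else 1 / sqrt (real n))"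

text \<open>For \<open>\<gamma> = 0\<close> the division convention gives \<open>1 / \<gamma> = 0\<close>, so the form is just \<open>diag(x)\<close>.\<close>

lemma root_vectors:
  assumes n: "n \<noteq> 0" and d: "d = linear_deg \<gamma> n" and inj: "inj_on y {..<d}"
    and ne: "\<And>k i. k < d \<Longrightarrow> i < n \<Longrightarrow> y k \<noteq> x i"
    and sum: "\<And>k. k < d \<Longrightarrow> (\<Sum>i<n. 1 / (y k - x i)) = \<gamma>"
  defines "U \<equiv> root_vectors n d x y"
  shows "orthonormal n U"
    and "\<And>j l. j < d \<Longrightarrow> l < d \<Longrightarrow> rank_one_form n (1 / \<gamma>) x (U j) (U l) = (if j = l then y j else 0)"
proof -
  define N where "N j = sqrt (\<Sum>i<n. 1 / (y j - x i)\<^sup>2)" for j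
  have pos: "0 < (\<Sum>i<n. 1 / (y j - x i)\<^sup>2)" if "j < d" for j
    using n ne[OF that] by (intro sum_pos) auto
  have N: "N j > 0" "N j * N j = (\<Sum>i<n. 1 / (y j - x i)\<^sup>2)" if "j < d" for j
    using pos[OF that] by (simp_all add: N_def)
  have U: "U j i = 1 / N j * (1 / (y j - x i))" if "j < d" for i j
    using that by (simp add: U_def root_vectors_def N_def)
  have orth: "(\<Sum>i<n. 1 / (y j - x i) * (1 / (y l - x i))) = (if j = l then N j * N j else 0)"
    if jl: "j < d" "l < d" for j l
  proof (cases "j = l")
    case True
    then show ?thesis using N(2)[of l] that by (simp add: power2_eq_square)
  next
    case False
    then have yne: "y l - y j \<noteq> 0" using inj that by (auto dest: inj_onD)
    \<comment> \<open>Partial fractions: the two sums that result are both \<open>\<gamma>\<close>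
      and cancel.\<close>
    have "(\<Sum>i<n. 1 / (y j - x i) * (1 / (y l - x i))) =
        (\<Sum>i<n. (1 / (y j - x i) - 1 / (y l - x i)) / (y l - y j))"
    proof (intro sum.cong refl)
      fix i assume "i \<in> {..<n}"
      then have "y j - x i \<noteq> 0" "y l - x i \<noteq> 0" using ne that by auto
      then show "1 / (y j - x i) * (1 / (y l - x i)) = (1 / (y j - x i) - 1 / (y l - x i)) / (y l - y j)"
        using yne by (simp add: divide_simps)
    qed
    also have "\<dots> = 0"
      using sum that by (simp add: sum_subtractf flip: sum_divide_distrib)
    finally show ?thesis using False by simp
  qed
  have UU: "(\<Sum>i<n. U j i * U l i) = (if j = l then 1 else 0)" if jl: "j < d" "l < d" for j l
  proof -
    have "(\<Sum>i<n. U j i * U l i) = 1 / N j * (1 / N l) * (\<Sum>i<n. 1 / (y j - x i) * (1 / (y l - x i)))"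
      using that by (simp add: U sum_distrib_left mult_ac)
    then show ?thesis using N(1)[of j] N(1)[of l] that by (simp only: orth) auto
  qed
  have sumU: "(\<Sum>i<n. U j i) = \<gamma> / N j" if "j < d" for j
    using sum[OF that] that by (simp only: U flip: sum_distrib_left) simp
  show "orthonormal n U"
    unfolding orthonormal_def
  proof (intro allI impI)
    fix j l assume jl: "j < n" "l < n"
    \<comment> \<open>An index from \<open>d\<close> on exists only for \<open>\<gamma> = 0\<close>
      and is then unique; in that case \<open>sumU\<close> says that the other vectors are
      orthogonal to the constants.\<close>
    have last: "\<gamma> = 0 \<and> j = n - 1" if "\<not> j < d" "j < n" for j
      using that d by (auto simp: linear_deg_def split: if_splits)
    have c: "U j i = 1 / sqrt (real n)" if "\<not> j < d" for i j
      using that by (simp add: U_def root_vectors_def)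
    have sc: "(\<Sum>i<n. U j i * U l i) = 0" if "j < d" "\<not> l < d" "l < n" for j l
      using that sumU[of j] last[of l] by (simp add: c flip: sum_divide_distrib)
    consider "j < d" "l < d" | "j < d" "\<not> l < d" | "\<not> j < d" "l < d" | "\<not> j < d" "\<not> l < d" by blast
    then show "(\<Sum>i<n. U j i * U l i) = (if j = l then 1 else 0)"
    proof cases
      case 1
      then show ?thesis by (rule UU)
    next
      case 2
      then show ?thesis using sc[of j l] jl by auto
    next
      case 3
      then show ?thesis using sc[of l j] jl by (auto simp: mult.commute)
    next
      case 4
      then have "j = l" using jl last[of j] last[of l] by simp
      then show ?thesis using 4 n by (simp add: c)
    qed
  qed
  fix j l assume jl: "j < d" "l < d"
  \<comment> \<open>From \<open>x / (y - x) = y / (y - x) - 1\<close>. The constant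
    \<open>- 1\<close> yields the term \<open>- \<gamma> / (N j * N l)\<close>, which the rank-one
    part cancels; for \<open>\<gamma> = 0\<close> both are zero.\<close>
  have "(\<Sum>i<n. x i * U j i * U l i) = (\<Sum>i<n. y j * (U j i * U l i) - 1 / N j * U l i)"
  proof (intro sum.cong refl)
    fix i assume "i \<in> {..<n}"
    then have "y j - x i \<noteq> 0" using ne jl by auto
    then have "x i * (1 / (y j - x i)) = y j * (1 / (y j - x i)) - 1" by (simp add: divide_simps)
    then have "1 / N j * (x i * (1 / (y j - x i))) = 1 / N j * (y j * (1 / (y j - x i)) - 1)" by simp
    then have "x i * U j i = y j * U j i - 1 / N j" using jl by (simp add: U right_diff_distrib mult.left_commute)
    then have "x i * U j i * U l i = (y j * U j i - 1 / N j) * U l i" by (simp only:)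
    then show "x i * U j i * U l i = y j * (U j i * U l i) - 1 / N j * U l i"
      by (simp add: left_diff_distrib)
  qed
  also have "\<dots> = y j * (if j = l then 1 else 0) - 1 / N j * (\<gamma> / N l)"
    using jl by (simp only: sum_subtractf UU sumU flip: sum_distrib_left)
  finally show "rank_one_form n (1 / \<gamma>) x (U j) (U l) = (if j = l then y j else 0)"
    using jl by (simp add: rank_one_form_def sumU)
qed

section \<open>The spectral order as a relation between multisets\<close>

definition convex_le :: "real multiset \<Rightarrow> real multiset \<Rightarrow> bool" where
  "convex_le A B \<longleftrightarrow> size A = size B \<and>
     (\<forall>f. convex_on UNIV f \<longrightarrow> (\<Sum>x\<in>#A. f x) \<le> (\<Sum>x\<in>#B. f x))"

lemma convex_le_refl [simp]: "convex_le A A"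
  by (simp add: convex_le_def)

lemma convex_le_trans [trans]: "convex_le A B \<Longrightarrow> convex_le B C \<Longrightarrow> convex_le A C"
  by (fastforce simp: convex_le_def)

lemma sum_nth_mset: "(\<Sum>i<length xs. f (xs ! i)) = (\<Sum>x\<in>#mset xs. f x :: real)"
proof -
  have "(\<Sum>i<length xs. f (xs ! i)) = sum_list (map f xs)"
    by (simp add: sum_list_sum_nth atLeast0LessThan)
  then show ?thesis by (simp flip: sum_mset_sum_list)
qed

lemma spectral_le_iff: "X \<prec> Y \<longleftrightarrow> convex_le (mset X) (mset Y)"
  by (simp add: spectral_le_def convex_le_def sum_nth_mset)

lemma poly_spectral_le_iff: "Q \<preceq> P \<longleftrightarrow> convex_le (proots Q) (proots P)"
  by (simp add: poly_spectral_le_def spectral_le_iff mset_zeros)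

text \<open>Both \<open>x\<close> and \<open>- x\<close> are convex, which forces equal sums; the
  hinges are convex as well.\<close>

lemma convex_le_imp_hinge_le:
  assumes "convex_le A B"
  shows "hinge_le A B"
proof -
  have le: "(\<Sum>x\<in>#A. f x) \<le> (\<Sum>x\<in>#B. f x)" if "convex_on UNIV f" for f
    using assms that by (simp add: convex_le_def)
  have neg: "(\<Sum>x\<in>#M. - x) = - \<Sum>\<^sub># M" for M :: "real multiset"
    by (induction M) auto
  have "convex_on UNIV (\<lambda>x::real. x)" "convex_on UNIV (\<lambda>x::real. - x)"
    by (auto intro!: convex_onI simp: algebra_simps)
  from this[THEN le] have "\<Sum>\<^sub># A = \<Sum>\<^sub># B"
    by (simp add: neg)
  moreover have "convex_on UNIV (\<lambda>x::real. max 0 (x - c))" for c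
  proof (rule convex_onI)
    fix t x y :: real
    assume t: "0 < t" "t < 1"
    have "(1 - t) * (x - c) \<le> (1 - t) * max 0 (x - c)" "t * (y - c) \<le> t * max 0 (y - c)"
      using t by (auto intro!: mult_left_mono)
    moreover have "0 \<le> (1 - t) * max 0 (x - c)" "0 \<le> t * max 0 (y - c)" using t by auto
    ultimately show "max 0 ((1 - t) *\<^sub>R x + t *\<^sub>R y - c) \<le> (1 - t) * max 0 (x - c) + t * max 0 (y - c)"
      unfolding real_scaleR_def by (intro max.boundedI) (simp_all add: algebra_simps)
  qed simp
  ultimately show ?thesis using assms le by (simp add: hinge_le_def convex_le_def)
qed

text \<open>With distinct zeros before and after the averaging, the vectors
  \<open>root_vectors\<close> diagonalise both forms, so the zeros of the two images are the
  eigenvalues compared in \<open>eigenvalues_pair_transfer\<close>.\<close>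

lemma linear_op_distinct_transfer:
  fixes n :: nat
  assumes x: "inj_on x {..<n}" and x': "inj_on x' {..<n}" and n: "\<gamma> \<noteq> 0 \<or> n \<noteq> 0"
    and \<theta>: "0 \<le> \<theta>" "\<theta> \<le> 1"
    and \<pi>: "bij_betw \<pi> {..<n} {..<n}" "\<And>i. i < n \<Longrightarrow> \<pi> (\<pi> i) = i"
    and eq: "\<And>i. i < n \<Longrightarrow> x' i = (1 - \<theta>) * x i + \<theta> * x (\<pi> i)"
  shows "convex_le (proots (linear_op \<gamma> (root_poly (image_mset x' (mset_set {..<n})))))
    (proots (linear_op \<gamma> (root_poly (image_mset x (mset_set {..<n})))))"
proof (cases "n = 0")
  case False
  define d where "d = linear_deg \<gamma> n"
  have "d \<le> n" by (simp add: d_def linear_deg_def)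
  obtain y where y: "inj_on y {..<d}"
    "proots (linear_op \<gamma> (root_poly (image_mset x (mset_set {..<n})))) = image_mset y (mset_set {..<d})"
    "\<And>k i. k < d \<Longrightarrow> i < n \<Longrightarrow> y k \<noteq> x i" "\<And>k. k < d \<Longrightarrow> (\<Sum>i<n. 1 / (y k - x i)) = \<gamma>"
    using linear_op_simple_roots[OF x n] unfolding d_def by metis
  obtain y' where y': "inj_on y' {..<d}"
    "proots (linear_op \<gamma> (root_poly (image_mset x' (mset_set {..<n})))) = image_mset y' (mset_set {..<d})"
    "\<And>k i. k < d \<Longrightarrow> i < n \<Longrightarrow> y' k \<noteq> x' i" "\<And>k. k < d \<Longrightarrow> (\<Sum>i<n. 1 / (y' k - x' i)) = \<gamma>"
    using linear_op_simple_roots[OF x' n] unfolding d_def by metis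
  note U = root_vectors[OF False d_def y(1) y(3) y(4)]
  note V = root_vectors[OF False d_def y'(1) y'(3) y'(4)]
  have "(\<Sum>k<d. f (y' k)) \<le> (\<Sum>j<d. f (y j))" if "convex_on UNIV f" for f
  proof (rule eigenvalues_pair_transfer[where x = x and x' = x', OF that \<open>d \<le> n\<close> \<theta> \<pi> eq])
    show "orthonormal n (root_vectors n d x y)" "orthonormal n (root_vectors n d x' y')"
      using U(1) V(1) by auto
    show "rank_one_form n (1 / \<gamma>) x (root_vectors n d x y j) (root_vectors n d x y l) = (if j = l then y j else 0)"
      if "j < d" "l < d" for j l using U(2) that by auto
    show "rank_one_form n (1 / \<gamma>) x' (root_vectors n d x' y' k) (root_vectors n d x' y' k) = y' k"
      if "k < d" for k using V(2)[of k k] that by auto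
    show "root_vectors n d x y j i = 1 / sqrt (real n) \<and> root_vectors n d x' y' j i = 1 / sqrt (real n)"
      if "d \<le> j" for i j using that by (simp add: root_vectors_def)
  qed
  then show ?thesis
    unfolding convex_le_def y(2) y'(2)
    by (simp add: sum_unfold_sum_mset image_mset.compositionality comp_def)
qed simp

section \<open>Closedness of the spectral order\<close>

text \<open>Bolzano-Weierstrass, refining the subsequence one coordinate at a time.\<close>

lemma simultaneous_convergent_subseq:
  fixes a :: "nat \<Rightarrow> nat \<Rightarrow> real"
  assumes "\<And>N i. i < d \<Longrightarrow> \<bar>a N i\<bar> \<le> B"
  obtains r l where "strict_mono r" "\<And>i. i < d \<Longrightarrow> (\<lambda>N. a (r N) i) \<longlonglongrightarrow> l i"
proof -
  have "\<exists>r l. strict_mono r \<and> (\<forall>i<d. (\<lambda>N. a (r N) i) \<longlonglongrightarrow> l i)"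
    using assms
  proof (induction d)
    case 0
    show ?case by (intro exI[of _ id]) (auto simp: strict_mono_def)
  next
    case (Suc d)
    then obtain r l where r: "strict_mono r" "\<And>i. i < d \<Longrightarrow> (\<lambda>N. a (r N) i) \<longlonglongrightarrow> l i"
      by (metis less_SucI)
    have "bounded (range (\<lambda>N. a (r N) d))"
      using Suc.prems by (intro boundedI[of _ B]) auto
    then obtain m s where s: "strict_mono s" "((\<lambda>N. a (r N) d) \<circ> s) \<longlonglongrightarrow> m"
      using bounded_imp_convergent_subsequence by blast
    have "(\<lambda>N. a ((r \<circ> s) N) i) \<longlonglongrightarrow> (l(d := m)) i" if "i < Suc d" for i
    proof (cases "i = d")
      case True
      then show ?thesis using s(2) by (simp add: comp_def)
    next
      case False
      then show ?thesis using that LIMSEQ_subseq_LIMSEQ[OF r(2) s(1)] by (simp add: comp_def)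
    qed
    then show ?case using strict_mono_o[OF r(1) s(1)] by blast
  qed
  then show thesis using that by blast
qed

section \<open>Coefficientwise limits of polynomials\<close>

definition coeffs_tendsto :: "(nat \<Rightarrow> real poly) \<Rightarrow> real poly \<Rightarrow> bool" where
  "coeffs_tendsto p q \<longleftrightarrow> (\<forall>i. (\<lambda>N. coeff (p N) i) \<longlonglongrightarrow> coeff q i)"

lemma coeffs_tendsto_unique: "coeffs_tendsto p q \<Longrightarrow> coeffs_tendsto p q' \<Longrightarrow> q = q'"
  unfolding coeffs_tendsto_def by (metis LIMSEQ_unique poly_eqI)

lemma coeffs_tendsto_const: "coeffs_tendsto (\<lambda>_. q) q"
  by (simp add: coeffs_tendsto_def)

lemma coeffs_tendsto_subseq: "coeffs_tendsto p q \<Longrightarrow> strict_mono r \<Longrightarrow> coeffs_tendsto (\<lambda>N. p (r N)) q"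
  unfolding coeffs_tendsto_def
  using LIMSEQ_subseq_LIMSEQ[where X = "\<lambda>N. coeff (p N) i" for i] by (simp add: comp_def)

lemma coeffs_tendsto_mult:
  "coeffs_tendsto p p' \<Longrightarrow> coeffs_tendsto q q' \<Longrightarrow> coeffs_tendsto (\<lambda>N. p N * q N) (p' * q')"
  unfolding coeffs_tendsto_def coeff_mult by (auto intro!: tendsto_intros)

lemma coeffs_tendsto_smult:
  "c \<longlonglongrightarrow> c' \<Longrightarrow> coeffs_tendsto q q' \<Longrightarrow> coeffs_tendsto (\<lambda>N. smult (c N) (q N)) (smult c' q')"
  unfolding coeffs_tendsto_def by (auto intro!: tendsto_intros)

lemma coeffs_tendsto_sum:
  "(\<And>k. k \<in> K \<Longrightarrow> coeffs_tendsto (\<lambda>N. p N k) (q k)) \<Longrightarrow>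
    coeffs_tendsto (\<lambda>N. \<Sum>k\<in>K. p N k) (\<Sum>k\<in>K. q k)"
  unfolding coeffs_tendsto_def by (auto intro!: tendsto_intros simp: coeff_sum)

lemma coeffs_tendsto_linear_op:
  "coeffs_tendsto q q' \<Longrightarrow> coeffs_tendsto (\<lambda>N. linear_op \<gamma> (q N)) (linear_op \<gamma> q')"
  unfolding coeffs_tendsto_def linear_op_def
  by (auto intro!: tendsto_intros simp: coeff_pderiv)

lemma coeffs_tendsto_root_poly:
  fixes d :: nat
  assumes "\<And>i. i < d \<Longrightarrow> (\<lambda>N. a N i) \<longlonglongrightarrow> l i"
  shows "coeffs_tendsto (\<lambda>N. root_poly (image_mset (a N) (mset_set {..<d})))
           (root_poly (image_mset l (mset_set {..<d})))"
  using assms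
proof (induction d)
  case (Suc d)
  have "coeffs_tendsto (\<lambda>N. [:- a N d, 1:]) [:- l d, 1:]"
    unfolding coeffs_tendsto_def using Suc.prems[of d]
    by (auto simp: coeff_pCons split: nat.split intro!: tendsto_intros)
  moreover have "coeffs_tendsto (\<lambda>N. root_poly (image_mset (a N) (mset_set {..<d})))
           (root_poly (image_mset l (mset_set {..<d})))"
    using Suc by simp
  ultimately show ?case
    by (simp add: lessThan_Suc coeffs_tendsto_mult del: mult_pCons_left)
qed (simp add: coeffs_tendsto_const)

text \<open>A Cauchy-type bound, uniform over polynomials with bounded coefficients and leading
  coefficient away from 0. If \<open>\<bar>x\<bar> > 1\<close>, the lower terms add up to at most
  \<open>d * B * \<bar>x\<bar> ^ (d - 1)\<close>.\<close>

lemma root_bound: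
  assumes "degree p = d" "\<And>i. \<bar>coeff p i\<bar> \<le> B" "0 < b" "b \<le> \<bar>lead_coeff p\<bar>" "poly p (x::real) = 0"
  shows "\<bar>x\<bar> \<le> 1 + real d * B / b"
proof (rule ccontr)
  assume "\<not> ?thesis"
  moreover have "0 \<le> B" using assms(2)[of 0] by linarith
  moreover from this have "0 \<le> real d * B / b" using \<open>0 < b\<close> by simp
  ultimately have x: "1 < \<bar>x\<bar>" "real d * B / b < \<bar>x\<bar>" by linarith+
  have "d \<noteq> 0"
  proof
    assume "d = 0"
    with assms(1) obtain c where "p = [:c:]" by (metis degree_eq_zeroE)
    with assms show False by simp
  qed
  then obtain e where e: "d = Suc e" by (cases d) auto
  have "(\<Sum>i<d. coeff p i * x ^ i) + lead_coeff p * x ^ d = 0"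
    using assms(1,5) by (simp add: poly_altdef lessThan_Suc_atMost[symmetric])
  then have "\<bar>lead_coeff p * x ^ d\<bar> = \<bar>\<Sum>i<d. coeff p i * x ^ i\<bar>" by linarith
  also have "\<dots> \<le> (\<Sum>i<d. \<bar>coeff p i * x ^ i\<bar>)" by (rule sum_abs)
  also have "\<dots> \<le> (\<Sum>i<d. B * \<bar>x\<bar> ^ e)"
  proof (rule sum_mono)
    fix i assume "i \<in> {..<d}"
    then have "\<bar>x\<bar> ^ i \<le> \<bar>x\<bar> ^ e" using x e by (intro power_increasing) auto
    then show "\<bar>coeff p i * x ^ i\<bar> \<le> B * \<bar>x\<bar> ^ e"
      unfolding abs_mult power_abs using assms(2)[of i] \<open>0 \<le> B\<close> by (intro mult_mono) auto
  qed
  finally have "\<bar>lead_coeff p\<bar> * \<bar>x\<bar> ^ d \<le> real d * B * \<bar>x\<bar> ^ e"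
    by (simp add: abs_mult power_abs)
  moreover have "b * \<bar>x\<bar> ^ d \<le> \<bar>lead_coeff p\<bar> * \<bar>x\<bar> ^ d"
    using assms(4) by (intro mult_right_mono) auto
  ultimately have "(b * \<bar>x\<bar>) * \<bar>x\<bar> ^ e \<le> (real d * B) * \<bar>x\<bar> ^ e" by (simp add: e mult_ac)
  moreover have "0 < \<bar>x\<bar> ^ e" using x by simp
  ultimately have "b * \<bar>x\<bar> \<le> real d * B" by simp
  then show False using x \<open>0 < b\<close> by (simp add: field_simps)
qed

text \<open>Since the degree is fixed, the zeros stay bounded and converge along a subsequence. The
  product of the limiting linear factors has the limiting coefficients, so it is \<open>q\<close> up
  to its leading coefficient; this identifies the zeros of \<open>q\<close> and shows that they are
  all real.\<close>

lemma coeffs_tendsto_roots_subseq: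
  assumes lim: "coeffs_tendsto p q" and q: "q \<noteq> 0" "degree q = d"
    and p: "\<And>N. p N \<noteq> 0" "\<And>N. degree (p N) = d" "\<And>N. real_rooted (p N)"
  obtains r y l where "strict_mono r" "\<And>i. i < d \<Longrightarrow> (\<lambda>N. y N i) \<longlonglongrightarrow> l i"
    "\<And>N. proots (p (r N)) = image_mset (y N) (mset_set {..<d})"
    "proots q = image_mset l (mset_set {..<d})" "real_rooted q"
proof -
  define x where "x N i = zeros (p N) ! i" for N i
  have x: "proots (p N) = image_mset (x N) (mset_set {..<d})" for N
  proof -
    have "length (zeros (p N)) = d" using p by (simp add: length_zeros)
    then have "zeros (p N) = map (x N) [0..<d]" by (intro nth_equalityI) (simp_all add: x_def)
    then have "proots (p N) = mset (map (x N) [0..<d])" by (simp flip: mset_zeros)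
    then show ?thesis by (simp add: atLeast0LessThan)
  qed
  have conv: "(\<lambda>N. coeff (p N) i) \<longlonglongrightarrow> coeff q i" for i using lim by (simp add: coeffs_tendsto_def)
  define b where "b = \<bar>lead_coeff q\<bar> / 2"
  have lcq: "coeff q d \<noteq> 0" using q by (metis leading_coeff_neq_0)
  then have b: "0 < b" using q by (simp add: b_def)
  have lc: "eventually (\<lambda>N. b < \<bar>lead_coeff (p N)\<bar>) sequentially"
    using order_tendstoD(1)[OF tendsto_rabs[OF conv[of d]], of b] b q p(2) by (simp add: b_def)
  then obtain N0 where N0: "\<And>N. N \<ge> N0 \<Longrightarrow> b < \<bar>lead_coeff (p N)\<bar>"
    by (auto simp: eventually_sequentially)
  have "\<exists>B. \<forall>N. \<bar>coeff (p N) i\<bar> \<le> B" for i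
    using convergent_imp_Bseq[OF convergentI[OF conv[of i]]] by (auto simp: Bseq_def)
  then obtain B where B: "\<And>i N. \<bar>coeff (p N) i\<bar> \<le> B i" by metis
  define B' where "B' = (\<Sum>i\<le>d. B i)"
  have B0: "0 \<le> B i" for i using B[of 0 i] by linarith
  have B': "\<bar>coeff (p N) i\<bar> \<le> B'" for i N
  proof (cases "i \<le> d")
    case True
    then have "B i \<le> B'" unfolding B'_def using B0 by (intro member_le_sum) auto
    then show ?thesis using B[of N i] by linarith
  next
    case False
    then show ?thesis using p(2)[of N] B0 by (simp add: coeff_eq_0 B'_def sum_nonneg)
  qed
  have bound: "\<bar>x (N + N0) i\<bar> \<le> 1 + real d * B' / b" if "i < d" for N i
  proof (rule root_bound[OF p(2) B' b])
    show "b \<le> \<bar>lead_coeff (p (N + N0))\<bar>" using N0[of "N + N0"] by simp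
    have "x (N + N0) i \<in># proots (p (N + N0))" using that by (simp add: x)
    then show "poly (p (N + N0)) (x (N + N0) i) = 0" using p(1) by simp
  qed
  obtain r l where r: "strict_mono r" "\<And>i. i < d \<Longrightarrow> (\<lambda>N. x (r N + N0) i) \<longlonglongrightarrow> l i"
    using simultaneous_convergent_subseq[of d "\<lambda>N. x (N + N0)", OF bound] by metis
  \<comment> \<open>The shift by \<open>N0\<close> starts the sequence where the leading
    coefficients exceed \<open>b\<close>, so the root bound holds from the first term on.\<close>
  define s where "s N = r N + N0" for N
  have s: "strict_mono s" using r(1) by (simp add: strict_mono_def s_def)
  define L where "L = image_mset l (mset_set {..<d})"
  have "coeffs_tendsto (\<lambda>N. smult (coeff (p (s N)) d) (root_poly (image_mset (x (s N)) (mset_set {..<d}))))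
      (smult (coeff q d) (root_poly L))"
    unfolding L_def
    by (intro coeffs_tendsto_smult coeffs_tendsto_root_poly)
       (use r(2) LIMSEQ_subseq_LIMSEQ[OF conv s] in \<open>simp_all add: s_def comp_def\<close>)
  moreover have "smult (coeff (p N) d) (root_poly (image_mset (x N) (mset_set {..<d}))) = p N" for N
    using real_rooted_eq_root_poly[of "p N"] p x by metis
  ultimately have "coeffs_tendsto (\<lambda>N. p (s N)) (smult (coeff q d) (root_poly L))" by simp
  then have q_eq: "q = smult (coeff q d) (root_poly L)"
    by (rule coeffs_tendsto_unique[OF coeffs_tendsto_subseq[OF lim s]])
  have "real_rooted q" "proots q = L"
    using lcq real_rooted_root_poly[of L] by (subst q_eq, simp)+
  then show thesis
    using that[OF s, of "\<lambda>N. x (s N)" l] r(2) x by (simp add: s_def L_def)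
qed

lemma real_rooted_limit:
  assumes "coeffs_tendsto p q" and "q \<noteq> 0"
    and "\<And>N. p N \<noteq> 0" "\<And>N. degree (p N) = degree q" "\<And>N. real_rooted (p N)"
  shows "real_rooted q"
  by (rule coeffs_tendsto_roots_subseq[OF assms(1,2) refl assms(3-5)])

text \<open>Convex functions on the line are continuous, so both sums pass to the limit along a
  subsequence on which the zeros of both families converge.\<close>

lemma convex_le_limit:
  assumes P: "coeffs_tendsto p p'" "p' \<noteq> 0" "degree p' = d"
    "\<And>N. p N \<noteq> 0" "\<And>N. degree (p N) = d" "\<And>N. real_rooted (p N)"
    and Q: "coeffs_tendsto q q'" "q' \<noteq> 0" "degree q' = d"
    "\<And>N. q N \<noteq> 0" "\<And>N. degree (q N) = d" "\<And>N. real_rooted (q N)"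
    and le: "\<And>N. convex_le (proots (q N)) (proots (p N))"
  shows "convex_le (proots q') (proots p')"
proof -
  obtain r x k where r: "strict_mono r" "\<And>i. i < d \<Longrightarrow> (\<lambda>N. x N i) \<longlonglongrightarrow> k i"
    "\<And>N. proots (p (r N)) = image_mset (x N) (mset_set {..<d})"
    "proots p' = image_mset k (mset_set {..<d})" "real_rooted p'"
    by (rule coeffs_tendsto_roots_subseq[OF P]) (rule that; assumption)
  \<comment> \<open>Extracted inside the first subsequence, so that \<open>r\<close> after
    \<open>s\<close> serves both families.\<close>
  obtain s y l where s: "strict_mono s" "\<And>i. i < d \<Longrightarrow> (\<lambda>N. y N i) \<longlonglongrightarrow> l i"
    "\<And>N. proots (q (r (s N))) = image_mset (y N) (mset_set {..<d})"
    "proots q' = image_mset l (mset_set {..<d})" "real_rooted q'"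
    by (rule coeffs_tendsto_roots_subseq[OF coeffs_tendsto_subseq[OF Q(1) r(1)] Q(2-)]) (rule that; assumption)
  have "(\<Sum>i<d. f (l i)) \<le> (\<Sum>i<d. f (k i))" if f: "convex_on UNIV f" for f :: "real \<Rightarrow> real"
  proof (rule LIMSEQ_le)
    have "continuous_on UNIV f"
      using f by (intro convex_on_continuous) auto
    then have cont: "isCont f t" for t by (simp add: continuous_on_eq_continuous_at)
    show "(\<lambda>N. \<Sum>i<d. f (y N i)) \<longlonglongrightarrow> (\<Sum>i<d. f (l i))"
      using s(2) by (intro tendsto_sum isCont_tendsto_compose[OF cont]) auto
    show "(\<lambda>N. \<Sum>i<d. f (x (s N) i)) \<longlonglongrightarrow> (\<Sum>i<d. f (k i))"
      using LIMSEQ_subseq_LIMSEQ[OF r(2) s(1)]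
      by (intro tendsto_sum isCont_tendsto_compose[OF cont]) (auto simp: comp_def)
    have "(\<Sum>i<d. f (y N i)) \<le> (\<Sum>i<d. f (x (s N) i))" for N
      using le[of "r (s N)"] f
      by (simp add: convex_le_def s(3) r(3) sum_unfold_sum_mset image_mset.compositionality comp_def)
    then show "\<exists>M. \<forall>N\<ge>M. (\<Sum>i<d. f (y N i)) \<le> (\<Sum>i<d. f (x (s N) i))" by blast
  qed
  then show ?thesis
    by (simp add: convex_le_def s(4) r(4) sum_unfold_sum_mset image_mset.compositionality comp_def)
qed

section \<open>Monotonicity of linear differential operators\<close>

text \<open>The values are chosen one at a time: an interval of length \<open>\<epsilon>\<close> is
  infinite, and only finitely many of its points are forbidden.\<close>

lemma distinct_perturbation:
  fixes \<rho> :: "nat \<Rightarrow> real"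
  assumes "finite A" "0 < \<epsilon>"
  shows "\<exists>\<sigma>. inj_on \<sigma> {..<m} \<and> (\<forall>i<m. \<sigma> i \<notin> A \<and> \<bar>\<sigma> i - \<rho> i\<bar> < \<epsilon>)"
proof (induction m)
  case (Suc m)
  then obtain \<sigma> where \<sigma>: "inj_on \<sigma> {..<m}" "\<forall>i<m. \<sigma> i \<notin> A \<and> \<bar>\<sigma> i - \<rho> i\<bar> < \<epsilon>" by blast
  have "infinite ({\<rho> m <..< \<rho> m + \<epsilon>} - (A \<union> \<sigma> ` {..<m}))"
    using assms by (intro Diff_infinite_finite) (auto simp: infinite_Ioo)
  then obtain t where t: "t \<in> {\<rho> m <..< \<rho> m + \<epsilon>} - (A \<union> \<sigma> ` {..<m})"
    by (metis finite.emptyI subsetI subset_empty all_not_in_conv)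
  show ?case
  proof (intro exI conjI)
    show "inj_on (\<sigma>(m := t)) {..<Suc m}"
      using \<sigma>(1) t by (auto simp: inj_on_def less_Suc_eq)
    show "\<forall>i<Suc m. (\<sigma>(m := t)) i \<notin> A \<and> \<bar>(\<sigma>(m := t)) i - \<rho> i\<bar> < \<epsilon>"
      using \<sigma>(2) t by (auto simp: less_Suc_eq)
  qed
qed (simp)

text \<open>Places the pair to be averaged at the indices \<open>m\<close> and \<open>Suc m\<close>,
  which the transposition will exchange.\<close>

definition append_pair :: "nat \<Rightarrow> (nat \<Rightarrow> real) \<Rightarrow> real \<Rightarrow> real \<Rightarrow> nat \<Rightarrow> real" where
  "append_pair m \<rho> a b i = (if i < m then \<rho> i else if i = m then a else b)"

lemma image_append_pair:
  "image_mset (append_pair m \<rho> a b) (mset_set {..<Suc (Suc m)}) =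
     add_mset a (add_mset b (image_mset \<rho> (mset_set {..<m})))"
proof -
  have "image_mset (append_pair m \<rho> a b) (mset_set {..<m}) = image_mset \<rho> (mset_set {..<m})"
    by (intro image_mset_cong) (auto simp: append_pair_def)
  then show ?thesis by (simp add: lessThan_Suc append_pair_def add_mset_commute)
qed

lemma inj_append_pair:
  assumes "inj_on \<rho> {..<m}" "\<And>i. i < m \<Longrightarrow> \<rho> i \<notin> {a, b}" "a \<noteq> b"
  shows "inj_on (append_pair m \<rho> a b) {..<Suc (Suc m)}"
proof (rule inj_onI)
  fix i j assume "i \<in> {..<Suc (Suc m)}" "j \<in> {..<Suc (Suc m)}"
    and "append_pair m \<rho> a b i = append_pair m \<rho> a b j"
  then show "i = j" using assms(2)[of i] assms(2)[of j] assms(3) inj_onD[OF assms(1), of i j]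
    by (auto simp: append_pair_def less_Suc_eq split: if_splits)
qed

lemma tendsto_append_pair:
  assumes "\<And>i. i < m \<Longrightarrow> (\<lambda>N. \<rho> N i) \<longlonglongrightarrow> \<sigma> i" "a \<longlonglongrightarrow> a'" "b \<longlonglongrightarrow> b'"
  shows "(\<lambda>N. append_pair m (\<rho> N) (a N) (b N) i) \<longlonglongrightarrow> append_pair m \<sigma> a' b' i"
  using assms by (simp add: append_pair_def)

lemma linear_op_root_poly_facts:
  assumes "\<gamma> \<noteq> 0 \<or> size M \<noteq> 0"
  shows "linear_op \<gamma> (root_poly M) \<noteq> 0" "degree (linear_op \<gamma> (root_poly M)) = linear_deg \<gamma> (size M)"
    "real_rooted (linear_op \<gamma> (root_poly M))"
  using linear_op_degree[of "root_poly M" \<gamma>] real_rooted_linear_op[of "root_poly M" \<gamma>]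
    real_rooted_root_poly assms by simp_all

lemma transfer_parameter:
  fixes a b a' b' :: real
  assumes "a \<le> a'" "a' \<le> b" "a' + b' = a + b"
  obtains \<theta> where "0 \<le> \<theta>" "\<theta> \<le> 1" "a' = (1 - \<theta>) * a + \<theta> * b" "b' = (1 - \<theta>) * b + \<theta> * a"
proof (cases "a = b")
  case True
  then show thesis using assms that[of 0] by auto
next
  case False
  define \<theta> where "\<theta> = (a' - a) / (b - a)"
  have "a < b" using False assms by auto
  have a': "a' = (1 - \<theta>) * a + \<theta> * b"
  proof -
    have "\<theta> * (b - a) = a' - a" using \<open>a < b\<close> by (simp add: \<theta>_def)
    then show ?thesis by (simp add: algebra_simps)
  qed
  show thesis
  proof (rule that)
    show "0 \<le> \<theta>" "\<theta> \<le> 1" using \<open>a < b\<close> assms by (simp_all add: \<theta>_def)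
    show "b' = (1 - \<theta>) * b + \<theta> * a" using a' assms(3) by (simp add: algebra_simps)
  qed (fact a')
qed

text \<open>
  The pair is pushed apart and the remaining roots are moved by at most \<open>1 / (N + 1)\<close>, so that
  the roots before and after the transfer become distinct; the coefficient \<open>1/2\<close> is avoided
  because it would merge the pair.
\<close>

lemma linear_op_transfer:
  assumes "transfer Y X"
  shows "convex_le (proots (linear_op \<gamma> (root_poly X))) (proots (linear_op \<gamma> (root_poly Y)))"
  using assms
proof cases
  case (1 a a' b b' R)
  obtain \<theta> where \<theta>: "0 \<le> \<theta>" "\<theta> \<le> 1" "a' = (1 - \<theta>) * a + \<theta> * b" "b' = (1 - \<theta>) * b + \<theta> * a"
    using transfer_parameter[OF 1(3-5)] by blast
  define m where "m = size R"
  obtain rs where rs: "R = mset rs" by (metis ex_mset)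
  define \<rho> where "\<rho> i = rs ! i" for i
  have "length rs = m" by (simp add: m_def rs)
  then have "rs = map \<rho> [0..<m]" by (intro nth_equalityI) (simp_all add: \<rho>_def)
  then have "R = mset (map \<rho> [0..<m])" using rs by simp
  then have R: "R = image_mset \<rho> (mset_set {..<m})" by (simp add: atLeast0LessThan)
  define \<epsilon> where "\<epsilon> N = inverse (real (Suc N))" for N
  have \<epsilon>: "0 < \<epsilon> N" "\<epsilon> N \<le> 1" for N by (auto simp: \<epsilon>_def field_simps)
  have \<epsilon>_lim: "\<epsilon> \<longlonglongrightarrow> 0" unfolding \<epsilon>_def by (rule LIMSEQ_inverse_real_of_nat)
  define T where "T N = (if \<theta> = 1 / 2 then 1 / 2 - 1 / 2 * \<epsilon> N else \<theta>)" for N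
  have T: "0 \<le> T N" "T N \<le> 1" "T N \<noteq> 1 / 2" for N
    using \<theta>(1,2) \<epsilon>[of N] by (auto simp: T_def)
  have T_lim: "T \<longlonglongrightarrow> \<theta>"
  proof (cases "\<theta> = 1 / 2")
    case True
    have "(\<lambda>N. 1 / 2 - 1 / 2 * \<epsilon> N) \<longlonglongrightarrow> 1 / 2 - 1 / 2 * 0"
      by (intro tendsto_intros \<epsilon>_lim)
    moreover have "T = (\<lambda>N. 1 / 2 - 1 / 2 * \<epsilon> N)" using True by (simp add: T_def fun_eq_iff)
    ultimately show ?thesis unfolding True by simp
  qed (simp add: T_def[abs_def])
  define B where "B N = b + \<epsilon> N" for N
  have B_lim: "B \<longlonglongrightarrow> b"
    unfolding B_def using tendsto_add[OF tendsto_const \<epsilon>_lim, of b] by simp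
  have B: "a < B N" for N using 1 \<epsilon>(1)[of N] by (simp add: B_def)
  define A' where "A' N = (1 - T N) * a + T N * B N" for N
  define B' where "B' N = (1 - T N) * B N + T N * a" for N
  have A'_lim: "A' \<longlonglongrightarrow> a'" unfolding A'_def \<theta>(3) by (intro tendsto_intros T_lim B_lim)
  have B'_lim: "B' \<longlonglongrightarrow> b'" unfolding B'_def \<theta>(4) by (intro tendsto_intros T_lim B_lim)
  have A'B': "A' N \<noteq> B' N" for N
  proof
    assume "A' N = B' N"
    then have "(1 - 2 * T N) * (B N - a) = 0" by (simp add: A'_def B'_def algebra_simps)
    then show False using T(3)[of N] B[of N] by simp
  qed
  \<comment> \<open>The same perturbed roots occur in both tuples, so they have to avoid the pair
    before and the pair after the averaging.\<close>
  have "\<exists>\<sigma>. inj_on \<sigma> {..<m} \<and> (\<forall>i<m. \<sigma> i \<notin> {a, B N, A' N, B' N} \<and> \<bar>\<sigma> i - \<rho> i\<bar> < \<epsilon> N)" for N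
    by (rule distinct_perturbation) (use \<epsilon> in auto)
  then obtain \<sigma> where \<sigma>: "\<And>N. inj_on (\<sigma> N) {..<m}"
    "\<And>N i. i < m \<Longrightarrow> \<sigma> N i \<notin> {a, B N, A' N, B' N}" "\<And>N i. i < m \<Longrightarrow> \<bar>\<sigma> N i - \<rho> i\<bar> < \<epsilon> N"
    by metis
  have \<sigma>_lim: "(\<lambda>N. \<sigma> N i) \<longlonglongrightarrow> \<rho> i" if "i < m" for i
  proof (rule LIM_zero_cancel, rule Lim_null_comparison[OF _ \<epsilon>_lim])
    show "eventually (\<lambda>N. norm (\<sigma> N i - \<rho> i) \<le> \<epsilon> N) sequentially"
      using \<sigma>(3)[OF that] by (intro always_eventually allI) (simp add: less_imp_le)
  qed
  define n where "n = Suc (Suc m)"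
  define x where "x N = append_pair m (\<sigma> N) a (B N)" for N
  define x' where "x' N = append_pair m (\<sigma> N) (A' N) (B' N)" for N
  define M where "M N = image_mset (x N) (mset_set {..<n})" for N
  define M' where "M' N = image_mset (x' N) (mset_set {..<n})" for N
  have size: "size (M N) = n" "size (M' N) = n" for N by (simp_all add: M_def M'_def)
  have Y: "Y = image_mset (append_pair m \<rho> a b) (mset_set {..<n})"
    and X: "X = image_mset (append_pair m \<rho> a' b') (mset_set {..<n})"
    using 1 R by (simp_all add: n_def image_append_pair)
  have sizeXY: "size X = n" "size Y = n" by (simp_all add: X Y)
  have step: "convex_le (proots (linear_op \<gamma> (root_poly (M' N)))) (proots (linear_op \<gamma> (root_poly (M N))))" for N
    unfolding M_def M'_def
  proof (rule linear_op_distinct_transfer[where \<theta> = "T N" and \<pi> = "Transposition.transpose m (Suc m)"])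
    show "inj_on (x N) {..<n}" unfolding x_def n_def
      using \<sigma>(1)[of N] \<sigma>(2)[of _ N] B[of N] by (intro inj_append_pair) auto
    show "inj_on (x' N) {..<n}" unfolding x'_def n_def
      using \<sigma>(1)[of N] \<sigma>(2)[of _ N] A'B'[of N] by (intro inj_append_pair) auto
    show "bij_betw (Transposition.transpose m (Suc m)) {..<n} {..<n}"
      by (simp add: n_def)
    show "x' N i = (1 - T N) * x N i + T N * x N (Transposition.transpose m (Suc m) i)" if "i < n" for i
    proof -
      consider "i < m" | "i = m" | "i = Suc m" using \<open>i < n\<close> unfolding n_def by (metis less_SucE)
      then show ?thesis
      proof cases
        case 1
        then show ?thesis by (simp add: x_def x'_def append_pair_def transpose_apply_other algebra_simps)
      qed (simp_all add: x_def x'_def append_pair_def A'_def B'_def)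
    qed
  qed (use T in \<open>auto simp: n_def\<close>)
  have facts: "linear_op \<gamma> (root_poly K) \<noteq> 0" "degree (linear_op \<gamma> (root_poly K)) = linear_deg \<gamma> n"
      "real_rooted (linear_op \<gamma> (root_poly K))" if "size K = n" for K
    using linear_op_root_poly_facts[of \<gamma> K] that by (simp_all add: n_def)
  show ?thesis
  proof (rule convex_le_limit[where d = "linear_deg \<gamma> n"])
    show "coeffs_tendsto (\<lambda>N. linear_op \<gamma> (root_poly (M N))) (linear_op \<gamma> (root_poly Y))"
      unfolding M_def Y x_def
      by (intro coeffs_tendsto_linear_op coeffs_tendsto_root_poly tendsto_append_pair \<sigma>_lim B_lim tendsto_const)
    show "coeffs_tendsto (\<lambda>N. linear_op \<gamma> (root_poly (M' N))) (linear_op \<gamma> (root_poly X))"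
      unfolding M'_def X x'_def
      by (intro coeffs_tendsto_linear_op coeffs_tendsto_root_poly tendsto_append_pair \<sigma>_lim A'_lim B'_lim)
  qed (use step in \<open>simp_all add: facts size sizeXY\<close>)
qed

text \<open>A chain of transfers leads from \<open>B\<close> down to \<open>A\<close>; the images
  decrease at every link.\<close>

lemma linear_op_convex_le:
  assumes "convex_le A B"
  shows "convex_le (proots (linear_op \<gamma> (root_poly A))) (proots (linear_op \<gamma> (root_poly B)))"
proof -
  have "transfer\<^sup>*\<^sup>* B A" using assms by (intro hinge_le_imp_transfer convex_le_imp_hinge_le)
  then show ?thesis
  proof (induction rule: rtranclp_induct)
    case (step C D)
    then show ?case using linear_op_transfer convex_le_trans by blast
  qed simp
qed

lemma linear_op_proots_mono:
  assumes "p \<noteq> 0" "real_rooted p" "q \<noteq> 0" "real_rooted q" "convex_le (proots q) (proots p)"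
  shows "convex_le (proots (linear_op \<gamma> q)) (proots (linear_op \<gamma> p))"
proof -
  have "proots (linear_op \<gamma> r) = proots (linear_op \<gamma> (root_poly (proots r)))" if "r \<noteq> 0" "real_rooted r" for r
    using that by (subst real_rooted_eq_root_poly[OF that]) (simp add: linear_op_smult)
  then show ?thesis using assms linear_op_convex_le by simp
qed

section \<open>Monotone power series in the derivative\<close>

text \<open>The operator \<open>diff_op\<close> with the symbol as a real formal power series, so
  that products and coefficientwise limits of symbols can be formed without analysis.\<close>

definition fps_op :: "real fps \<Rightarrow> real poly \<Rightarrow> real poly" where
  "fps_op F p = (\<Sum>k\<le>degree p. smult (fps_nth F k) ((pderiv ^^ k) p))"

lemma higher_pderiv_eq_0: "degree (p :: real poly) < k \<Longrightarrow> (pderiv ^^ k) p = 0"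
  by (intro poly_eqI) (simp add: coeff_higher_pderiv coeff_eq_0)

lemma fps_op_bound:
  assumes "degree p \<le> N"
  shows "fps_op F p = (\<Sum>k\<le>N. smult (fps_nth F k) ((pderiv ^^ k) p))"
  unfolding fps_op_def using assms
  by (intro sum.mono_neutral_left) (auto simp: higher_pderiv_eq_0)

lemma degree_fps_op_le: "degree (fps_op F p) \<le> degree p"
  unfolding fps_op_def
  by (intro degree_sum_le) (auto intro: le_trans[OF degree_smult_le] simp: degree_higher_pderiv)

lemma smult_sum_right: "smult c (\<Sum>i\<in>A. f i) = (\<Sum>i\<in>A. smult c (f i))"
  by (induction A rule: infinite_finite_induct) (simp_all add: smult_add_right)

text \<open>Both sums may run up to \<open>degree p\<close>. Pairs with \<open>i + j\<close> above
  the degree contribute nothing, and grouping the others by \<open>i + j\<close> gives the Cauchy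
  product.\<close>

lemma fps_op_mult: "fps_op (F * G) p = fps_op F (fps_op G p)"
proof -
  define N where "N = degree p"
  have "fps_op F (fps_op G p) = (\<Sum>i\<le>N. smult (fps_nth F i) ((pderiv ^^ i) (fps_op G p)))"
    by (rule fps_op_bound) (simp add: N_def degree_fps_op_le)
  also have "\<dots> = (\<Sum>i\<le>N. \<Sum>j\<le>N. smult (fps_nth F i * fps_nth G j) ((pderiv ^^ (i + j)) p))"
    by (simp add: fps_op_def N_def higher_pderiv_sum higher_pderiv_smult smult_sum_right funpow_add)
  also have "\<dots> = (\<Sum>(i, j)\<in>{..N} \<times> {..N}. smult (fps_nth F i * fps_nth G j) ((pderiv ^^ (i + j)) p))"
    by (simp add: sum.cartesian_product)
  also have "\<dots> = (\<Sum>(i, j)\<in>{(i, j). i + j \<le> N}. smult (fps_nth F i * fps_nth G j) ((pderiv ^^ (i + j)) p))"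
  proof (intro sum.mono_neutral_right ballI)
    fix ij assume ij: "ij \<in> {..N} \<times> {..N} - {(i, j). i + j \<le> N}"
    obtain i j where "ij = (i, j)" by (cases ij)
    with ij have "(pderiv ^^ (i + j)) p = 0" by (intro higher_pderiv_eq_0) (simp add: N_def)
    then show "(case ij of (i, j) \<Rightarrow> smult (fps_nth F i * fps_nth G j) ((pderiv ^^ (i + j)) p)) = 0"
      using \<open>ij = (i, j)\<close> by simp
  qed auto
  also have "\<dots> = (\<Sum>k\<le>N. \<Sum>i\<le>k. smult (fps_nth F i * fps_nth G (k - i)) ((pderiv ^^ k) p))"
    by (subst sum.triangle_reindex_eq) simp
  also have "\<dots> = fps_op (F * G) p"
    by (simp add: fps_op_def N_def fps_mult_nth atLeast0AtMost smult_sum)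
  finally show ?thesis ..
qed

lemma coeff_fps_op:
  "coeff (fps_op F p) i = (\<Sum>k\<le>degree p. fps_nth F k * (pochhammer (real (Suc i)) k * coeff p (i + k)))"
  by (simp add: fps_op_def coeff_sum coeff_higher_pderiv)

text \<open>The lowest term of \<open>F\<close> decides: at \<open>degree p - subdegree F\<close> it
  is the only one to contribute, and above that degree none does.\<close>

lemma fps_op_degree:
  assumes "p \<noteq> 0" "F \<noteq> 0" "subdegree F \<le> degree p"
  shows "fps_op F p \<noteq> 0 \<and> degree (fps_op F p) = degree p - subdegree F"
proof -
  define m where "m = subdegree F"
  define d where "d = degree p"
  have "coeff (fps_op F p) (d - m) =
      (\<Sum>k\<in>{m}. fps_nth F k * (pochhammer (real (Suc (d - m))) k * coeff p (d - m + k)))"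
    unfolding coeff_fps_op
  proof (intro sum.mono_neutral_right ballI)
    fix k assume "k \<in> {..degree p} - {m}"
    then consider "k < m" | "m < k" by force
    then show "fps_nth F k * (pochhammer (real (Suc (d - m))) k * coeff p (d - m + k)) = 0"
    proof cases
      case 1
      then have "fps_nth F k = 0" unfolding m_def by (rule nth_less_subdegree_zero)
      then show ?thesis by simp
    next
      case 2
      then have "degree p < d - m + k" using assms by (simp add: d_def m_def)
      then show ?thesis by (simp add: coeff_eq_0)
    qed
  qed (use assms(3) in \<open>simp_all add: m_def\<close>)
  also have "\<dots> \<noteq> 0"
  proof -
    have "d - m + m = degree p" using assms by (simp add: d_def m_def)
    then have "coeff p (d - m + m) \<noteq> 0" using leading_coeff_neq_0[OF assms(1)] by simp
    moreover have "fps_nth F m \<noteq> 0" using assms(2) by (simp add: m_def)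
    moreover have "0 < pochhammer (real (Suc (d - m))) m" by (rule pochhammer_pos) simp
    ultimately show ?thesis by simp
  qed
  finally have nz: "coeff (fps_op F p) (d - m) \<noteq> 0" .
  moreover have "degree (fps_op F p) \<le> d - m"
  proof (rule degree_le, intro allI impI)
    fix i assume i: "d - m < i"
    have "fps_nth F k * (pochhammer (real (Suc i)) k * coeff p (i + k)) = 0" for k
    proof (cases "k < m")
      case True
      then have "fps_nth F k = 0" unfolding m_def by (rule nth_less_subdegree_zero)
      then show ?thesis by simp
    next
      case False
      then have "degree p < i + k" using i by (simp add: d_def)
      then show ?thesis by (simp add: coeff_eq_0)
    qed
    then show "coeff (fps_op F p) i = 0" unfolding coeff_fps_op by (intro sum.neutral ballI)
  qed
  ultimately show ?thesis using le_degree[OF nz] by (auto simp: d_def m_def)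
qed

text \<open>Preservation of real-rootedness is included so that the property is stable under
  products: the second factor acts on the image under the first. The bound on
  \<open>subdegree F\<close> keeps images nonzero.\<close>

definition isotone :: "real fps \<Rightarrow> bool" where
  "isotone F \<longleftrightarrow> F \<noteq> 0 \<and>
     (\<forall>p. p \<noteq> 0 \<longrightarrow> real_rooted p \<longrightarrow> subdegree F \<le> degree p \<longrightarrow> real_rooted (fps_op F p)) \<and>
     (\<forall>p q. p \<noteq> 0 \<longrightarrow> real_rooted p \<longrightarrow> q \<noteq> 0 \<longrightarrow> real_rooted q \<longrightarrow> subdegree F \<le> degree p \<longrightarrow>
        convex_le (proots q) (proots p) \<longrightarrow> convex_le (proots (fps_op F q)) (proots (fps_op F p)))"

lemma convex_le_imp_degree_eq:
  assumes "p \<noteq> 0" "real_rooted p" "q \<noteq> 0" "real_rooted q" "convex_le (proots q) (proots p)"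
  shows "degree q = degree p"
  using assms real_rooted_size_proots by (auto simp: convex_le_def)

text \<open>Subdegrees add, so after \<open>G\<close> has lowered the degree by its subdegree there
  is enough degree left for \<open>F\<close>.\<close>

lemma isotone_mult:
  assumes F: "isotone F" and G: "isotone G"
  shows "isotone (F * G)"
  unfolding isotone_def
proof (intro conjI allI impI)
  have nz: "F \<noteq> 0" "G \<noteq> 0" using F G by (auto simp: isotone_def)
  then show "F * G \<noteq> 0" by simp
  fix p assume p: "p \<noteq> 0" "real_rooted p" "subdegree (F * G) \<le> degree p"
  then have sd: "subdegree G \<le> degree p" "subdegree F \<le> degree p - subdegree G" using nz by auto
  note Gp = fps_op_degree[OF p(1) nz(2) sd(1)]
  have rG: "real_rooted (fps_op G p)" using G p sd by (simp add: isotone_def)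
  then show "real_rooted (fps_op (F * G) p)"
    using F Gp sd by (simp add: isotone_def fps_op_mult)
  fix q assume q: "q \<noteq> 0" "real_rooted q" "convex_le (proots q) (proots p)"
  have deg: "degree q = degree p" using convex_le_imp_degree_eq[OF p(1,2) q] .
  note Gq = fps_op_degree[OF q(1) nz(2), unfolded deg, OF sd(1)]
  have "real_rooted (fps_op G q)" "convex_le (proots (fps_op G q)) (proots (fps_op G p))"
    using G p q sd deg by (simp_all add: isotone_def)
  then show "convex_le (proots (fps_op (F * G) q)) (proots (fps_op (F * G) p))"
    using F Gp Gq rG sd by (simp add: isotone_def fps_op_mult)
qed

text \<open>Equal subdegrees give all images the degree of the limit, so no zero escapes to infinity
  and the closedness results apply.\<close>

lemma isotone_limit:
  assumes lim: "\<And>k. (\<lambda>N. fps_nth (F N) k) \<longlonglongrightarrow> fps_nth G k" and G: "G \<noteq> 0"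
    and F: "\<And>N. isotone (F N)" "\<And>N. subdegree (F N) = subdegree G"
  shows "isotone G"
proof -
  have lim_op: "coeffs_tendsto (\<lambda>N. fps_op (F N) p) (fps_op G p)" for p
    unfolding fps_op_def by (intro coeffs_tendsto_sum coeffs_tendsto_smult lim coeffs_tendsto_const)
  have F0: "F N \<noteq> 0" for N using F by (simp add: isotone_def)
  have deg: "fps_op (F N) p \<noteq> 0 \<and> degree (fps_op (F N) p) = degree p - subdegree G"
    "fps_op G p \<noteq> 0 \<and> degree (fps_op G p) = degree p - subdegree G"
    if "p \<noteq> 0" "subdegree G \<le> degree p" for p N
    using fps_op_degree[OF that(1) F0, unfolded F(2)] fps_op_degree[OF that(1) G] that(2) by auto
  have rF: "real_rooted (fps_op (F N) p)" if "p \<noteq> 0" "real_rooted p" "subdegree G \<le> degree p" for p N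
    using F[of N] that by (simp add: isotone_def)
  show ?thesis
    unfolding isotone_def
  proof (intro conjI allI impI)
    fix p assume p: "p \<noteq> 0" "real_rooted p" "subdegree G \<le> degree p"
    show "real_rooted (fps_op G p)"
      using deg[OF p(1,3)] rF[OF p] by (intro real_rooted_limit[OF lim_op]) auto
    fix q assume q: "q \<noteq> 0" "real_rooted q" "convex_le (proots q) (proots p)"
    have dq: "degree q = degree p" using convex_le_imp_degree_eq[OF p(1,2) q] .
    then have q3: "subdegree G \<le> degree q" using p by simp
    have le: "convex_le (proots (fps_op (F N) q)) (proots (fps_op (F N) p))" for N
      using F[of N] p q by (simp add: isotone_def)
    show "convex_le (proots (fps_op G q)) (proots (fps_op G p))"
      using deg[OF p(1,3)] rF[OF p] deg[OF q(1) q3] rF[OF q(1,2) q3] dq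
      by (intro convex_le_limit[OF lim_op, of _ "degree p - subdegree G", OF _ _ _ _ _ lim_op _ _ _ _ _ le]) auto
  qed (fact G)
qed

section \<open>Constants, linear factors and their products\<close>

lemma isotone_nonzero: "isotone F \<Longrightarrow> F \<noteq> 0"
  by (simp add: isotone_def)

lemma isotone_const:
  assumes "c \<noteq> 0"
  shows "isotone (fps_const c)"
proof -
  have "fps_op (fps_const c) p = (\<Sum>k\<in>{0}. smult (fps_nth (fps_const c) k) ((pderiv ^^ k) p))" for p
    unfolding fps_op_def by (intro sum.mono_neutral_right) auto
  then have "fps_op (fps_const c) p = smult c p" for p by simp
  then show ?thesis using assms by (simp add: isotone_def)
qed

lemma isotone_1: "isotone 1"
  using isotone_const[of 1] by simp

lemma isotone_power: "isotone F \<Longrightarrow> isotone (F ^ n)"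
  by (induction n) (auto intro: isotone_1 isotone_mult)

lemma isotone_prod: "(\<And>x. x \<in> A \<Longrightarrow> isotone (f x)) \<Longrightarrow> isotone (\<Prod>x\<in>A. f x)"
  by (induction A rule: infinite_finite_induct) (auto intro: isotone_1 isotone_mult)

lemma fps_op_linear:
  assumes "\<And>k. 2 \<le> k \<Longrightarrow> fps_nth F k = 0"
  shows "fps_op F p = smult (fps_nth F 0) p + smult (fps_nth F 1) (pderiv p)"
proof -
  have "fps_op F p = (\<Sum>k\<le>Suc (degree p). smult (fps_nth F k) ((pderiv ^^ k) p))"
    by (rule fps_op_bound) simp
  also have "\<dots> = (\<Sum>k\<le>1. smult (fps_nth F k) ((pderiv ^^ k) p))"
    using assms by (intro sum.mono_neutral_right) auto
  finally show ?thesis by simp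
qed

lemma isotone_X: "isotone fps_X"
proof -
  have op: "fps_op fps_X p = smult (- 1) (linear_op 0 p)" for p
    by (subst fps_op_linear) (auto simp: linear_op_def fps_X_def)
  show ?thesis
    unfolding isotone_def op using real_rooted_linear_op[of _ 0] linear_op_proots_mono[of _ _ 0]
    by (auto simp del: smult_minus_left)
qed

lemma isotone_one_plus: "isotone (1 + fps_const c * fps_X)"
proof (cases "c = 0")
  case True
  then show ?thesis by (simp add: isotone_1)
next
  case False
  let ?F = "1 + fps_const c * fps_X :: real fps"
  have nth: "fps_nth ?F 0 = 1" "fps_nth ?F 1 = c" "\<And>k. 2 \<le> k \<Longrightarrow> fps_nth ?F k = 0"
    by (auto simp: fps_X_def)
  have op: "fps_op ?F p = smult (- c) (linear_op (- (1 / c)) p)" for p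
    using False nth by (subst fps_op_linear) (auto simp: linear_op_def smult_diff_right)
  have "?F \<noteq> 0" using nth(1) by (metis fps_zero_nth zero_neq_one)
  then show ?thesis
    unfolding isotone_def op using False real_rooted_linear_op[of _ "- (1 / c)"]
      linear_op_proots_mono[of _ _ "- (1 / c)"] by (auto simp del: smult_minus_left)
qed

section \<open>Exponential and Gaussian series as limits of powers\<close>

lemma one_plus_fps_X_power_nth:
  "fps_nth ((1 + fps_const c * fps_X) ^ n) k = of_nat (n choose k) * (c :: 'a::comm_ring_1) ^ k"
proof -
  have "(1 + fps_const c * fps_X) ^ n = (\<Sum>j\<le>n. of_nat (n choose j) * (fps_const c * fps_X) ^ j)"
    using binomial_ring[of "fps_const c * fps_X" 1 n] by (simp add: add.commute)
  also have "fps_nth \<dots> k = (\<Sum>j\<le>n. if j = k then of_nat (n choose j) * c ^ j else 0)"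
    unfolding fps_sum_nth
    by (intro sum.cong refl) (simp add: power_mult_distrib mult.assoc[symmetric] fps_of_nat[symmetric])
  also have "\<dots> = of_nat (n choose k) * c ^ k" by (simp add: binomial_eq_0)
  finally show ?thesis .
qed

text \<open>The coefficients of \<open>(1 + c x / n) ^ n\<close> tend to those of
  \<open>exp (c x)\<close>, by induction through the ratio of consecutive coefficients. The index
  \<open>Suc N\<close> keeps the denominator nonzero.\<close>

lemma binomial_tendsto_exp_coeff:
  "(\<lambda>N. real (Suc N choose k) * (c / real (Suc N)) ^ k) \<longlonglongrightarrow> c ^ k / fact k"
proof (induction k)
  case (Suc k)
  have rec: "real (n choose Suc k) * (c / real n) ^ Suc k =
      real (n choose k) * (c / real n) ^ k * ((1 - real k / real n) * (c / real (Suc k)))" if "n \<noteq> 0" for n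
  proof -
    have "real n * real (n choose k) = real k * real (n choose k) + real (Suc k) * real (n choose Suc k)"
      using gbinomial_mult_1[of "real n" k] by (simp only: binomial_gbinomial)
    then have "real (n choose Suc k) = (real n - real k) * real (n choose k) / real (Suc k)"
      by (simp add: field_simps)
    moreover have "1 - real k / real n = (real n - real k) / real n"
      using that by (simp add: diff_divide_distrib)
    ultimately show ?thesis by (simp add: mult_ac del: of_nat_Suc)
  qed
  have "(\<lambda>N. real k * inverse (real (Suc N))) \<longlonglongrightarrow> real k * 0"
    by (intro tendsto_intros LIMSEQ_inverse_real_of_nat)
  then have "(\<lambda>N. real k / real (Suc N)) \<longlonglongrightarrow> 0" by (simp add: divide_inverse)
  then have "(\<lambda>N. real (Suc N choose k) * (c / real (Suc N)) ^ k * ((1 - real k / real (Suc N)) * (c / real (Suc k))))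
      \<longlonglongrightarrow> c ^ k / fact k * ((1 - 0) * (c / real (Suc k)))"
    by (intro tendsto_intros Suc.IH)
  moreover have "c ^ k / fact k * ((1 - 0) * (c / real (Suc k))) = c ^ Suc k / fact (Suc k)"
    by (simp add: field_simps)
  ultimately show ?case by (simp only: rec[OF nat.distinct(2)])
qed simp

text \<open>The series of \<open>exp (c x ^ e)\<close> is the limit of
  \<open>(1 + c x ^ e / n) ^ n\<close>, all with constant coefficient 1 and hence subdegree 0. The
  cases \<open>e = 1\<close> and \<open>e = 2\<close> give the exponential and the Gaussian
  factor.\<close>

lemma isotone_exp_compose:
  assumes "0 < e" "\<And>N. isotone (1 + fps_const (c / real (Suc N)) * fps_X ^ e)"
  shows "isotone (fps_exp c oo fps_X ^ e)"
proof (rule isotone_limit)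
  let ?F = "\<lambda>N. (1 + fps_const (c / real (Suc N)) * fps_X ^ e) ^ Suc N :: real fps"
  have F: "?F N = (1 + fps_const (c / real (Suc N)) * fps_X) ^ Suc N oo fps_X ^ e" for N
    using assms(1) by (simp add: fps_compose_power[symmetric] fps_compose_add_distrib fps_compose_mult_distrib
        del: power_Suc of_nat_Suc)
  have nth: "fps_nth (?F N) k =
      (if e dvd k then real (Suc N choose (k div e)) * (c / real (Suc N)) ^ (k div e) else 0)" for N k
    unfolding F fps_nth_compose_X_power one_plus_fps_X_power_nth by simp
  show "(\<lambda>N. fps_nth (?F N) k) \<longlonglongrightarrow> fps_nth (fps_exp c oo fps_X ^ e) k" for k
    unfolding nth fps_nth_compose_X_power
    using binomial_tendsto_exp_coeff[of "k div e" c] by simp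
  have e0: "fps_nth (fps_exp c oo fps_X ^ e) 0 = 1"
    by (simp add: fps_nth_compose_X_power)
  then show "fps_exp c oo fps_X ^ e \<noteq> 0" by (metis fps_zero_nth zero_neq_one)
  show "isotone (?F N)" for N by (intro isotone_power assms(2))
  have "fps_nth (?F N) 0 \<noteq> 0" for N unfolding nth by simp
  then show "subdegree (?F N) = subdegree (fps_exp c oo fps_X ^ e)" for N
    using e0 by (metis subdegree_eq_0 zero_neq_one)
qed

lemma isotone_exp: "isotone (fps_exp c)"
  using isotone_exp_compose[of 1 c] isotone_one_plus by simp

text \<open>Because of the minus sign, \<open>1 - a^2 x^2 / n\<close> splits into two real linear
  factors.\<close>

lemma isotone_gaussian: "isotone (fps_exp (- a\<^sup>2) oo fps_X ^ 2)"
proof (rule isotone_exp_compose)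
  fix N
  define b where "b = a / sqrt (real (Suc N))"
  have "b * b = a\<^sup>2 / real (Suc N)"
    by (simp add: b_def power2_eq_square del: of_nat_Suc)
  then have "(1 + fps_const b * fps_X) * (1 + fps_const (- b) * fps_X) =
      1 + fps_const (- a\<^sup>2 / real (Suc N)) * fps_X ^ 2"
    by (simp add: algebra_simps power2_eq_square fps_const_neg[symmetric] del: fps_const_neg of_nat_Suc)
  then show "isotone (1 + fps_const (- a\<^sup>2 / real (Suc N)) * fps_X ^ 2)"
    by (metis isotone_mult isotone_one_plus)
qed simp

section \<open>Laguerre-Polya functions\<close>

text \<open>Links real symbols, on which \<open>isotone\<close> is defined, with power series
  expansions of complex functions.\<close>

definition complex_fps :: "real fps \<Rightarrow> complex fps" where
  "complex_fps F = Abs_fps (\<lambda>k. of_real (fps_nth F k))"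

lemma complex_fps_nth [simp]: "fps_nth (complex_fps F) k = of_real (fps_nth F k)"
  by (simp add: complex_fps_def)

lemma complex_fps_mult: "complex_fps (F * G) = complex_fps F * complex_fps G"
  by (rule fps_ext) (simp add: fps_mult_nth)

lemma complex_fps_eq_0 [simp]: "complex_fps F = 0 \<longleftrightarrow> F = 0"
  unfolding fps_eq_iff by simp

lemma subdegree_complex_fps [simp]: "subdegree (complex_fps F) = subdegree F"
proof (cases "F = 0")
  case False
  show ?thesis
  proof (rule subdegreeI)
    show "fps_nth (complex_fps F) (subdegree F) \<noteq> 0"
      unfolding complex_fps_nth of_real_eq_0_iff using False by (rule nth_subdegree_nonzero)
    show "fps_nth (complex_fps F) k = 0" if "k < subdegree F" for k
      unfolding complex_fps_nth of_real_eq_0_iff using that by (rule nth_less_subdegree_zero)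
  qed
next
  case True
  then have "complex_fps F = 0" by simp
  then show ?thesis by (simp only: True subdegree_0)
qed

lemma complex_fps_1 [simp]: "complex_fps 1 = 1"
  by (rule fps_ext) simp

lemma complex_fps_const: "complex_fps (fps_const c) = fps_const (of_real c)"
  by (rule fps_ext) simp

lemma complex_fps_X_power: "complex_fps (fps_X ^ n) = fps_X ^ n"
  by (rule fps_ext) simp

lemma complex_fps_one_plus: "complex_fps (1 + fps_const c * fps_X) = 1 + fps_const (of_real c) * fps_X"
  by (rule fps_ext) (simp add: fps_X_def)

lemma complex_fps_exp: "complex_fps (fps_exp c) = fps_exp (of_real c)"
  by (rule fps_ext) simp

lemma complex_fps_compose_X_power:
  "complex_fps (F oo fps_X ^ n) = complex_fps F oo fps_X ^ n"
  by (rule fps_ext) (simp add: fps_nth_compose_X_power)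

section \<open>Expansion of the infinite product\<close>

lemma has_complex_fps_prod:
  fixes f :: "nat \<Rightarrow> complex \<Rightarrow> complex"
  assumes "\<And>k. k \<in> A \<Longrightarrow> f k has_fps_expansion complex_fps (F k)"
  shows "(\<lambda>z. \<Prod>k\<in>A. f k z) has_fps_expansion complex_fps (\<Prod>k\<in>A. F k)"
  using assms
  by (induction A rule: infinite_finite_induct)
     (simp_all add: complex_fps_mult has_fps_expansion_mult)

text \<open>On the unit disc each factor differs from 1 by at most \<open>3 * (\<alpha> k)^2\<close>
  once \<open>\<bar>\<alpha> k\<bar> \<le> 1/2\<close>, so the M-test applies. The unit disc
  suffices for the Taylor coefficients at 0.\<close>

lemma laguerre_polya_product_uniform_limit:
  fixes \<alpha> :: "nat \<Rightarrow> real"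
  assumes "summable (\<lambda>k. (\<alpha> k)\<^sup>2)"
  defines "w \<equiv> \<lambda>k z. (1 - of_real (\<alpha> k) * z) * exp (of_real (\<alpha> k) * z) :: complex"
  shows "uniform_limit (cball 0 1) (\<lambda>K z. \<Prod>k<K. w k z) (\<lambda>z. \<Prod>k. w k z) sequentially"
proof -
  have w: "w k z = weierstrass_factor 1 (of_real (\<alpha> k) * z)" for k z
    by (simp add: w_def weierstrass_factor_def)
  have "(\<lambda>k. (\<alpha> k)\<^sup>2) \<longlonglongrightarrow> 0" using assms(1) by (rule summable_LIMSEQ_zero)
  then have "eventually (\<lambda>k. (\<alpha> k)\<^sup>2 < (1/2)\<^sup>2) sequentially"
    by (rule order_tendstoD(2)) simp
  then have ev: "eventually (\<lambda>k. \<forall>z\<in>cball 0 1. norm (norm (w k z - 1)) \<le> 3 * (\<alpha> k)\<^sup>2) sequentially"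
  proof eventually_elim
    case (elim k)
    then have a: "\<bar>\<alpha> k\<bar> \<le> 1 / 2" using power2_less_imp_less[of "\<bar>\<alpha> k\<bar>" "1/2"] by simp
    show ?case
    proof
      fix z :: complex assume z: "z \<in> cball 0 1"
      have le: "norm (of_real (\<alpha> k) * z) \<le> \<bar>\<alpha> k\<bar>"
        using z by (simp add: norm_mult mult_left_le)
      then have "norm (w k z - 1) \<le> 3 * norm (of_real (\<alpha> k) * z) ^ Suc 1"
        unfolding w using a by (intro weierstrass_factor_bound) simp
      also have "\<dots> \<le> 3 * \<bar>\<alpha> k\<bar> ^ Suc 1"
        using le by (intro mult_left_mono power_mono) auto
      finally show "norm (norm (w k z - 1)) \<le> 3 * (\<alpha> k)\<^sup>2" by (simp add: power2_eq_square)
    qed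
  qed
  have "uniformly_convergent_on (cball 0 1) (\<lambda>K z. \<Prod>k<K. w k z)"
  proof (rule uniformly_convergent_on_prod')
    show "continuous_on (cball 0 1) (w k)" for k unfolding w_def by (intro continuous_intros)
    show "uniformly_convergent_on (cball 0 1) (\<lambda>K z. \<Sum>k<K. norm (w k z - 1))"
      using ev summable_mult[OF assms(1), of 3] by (rule Weierstrass_m_test'_ev)
  qed simp
  then obtain g where g: "uniform_limit (cball 0 1) (\<lambda>K z. \<Prod>k<K. w k z) g sequentially"
    by (auto simp: uniformly_convergent_on_def)
  have "g z = (\<Prod>k. w k z)" if "z \<in> cball 0 1" for z
  proof (rule LIMSEQ_unique)
    show "(\<lambda>K. \<Prod>k<K. w k z) \<longlonglongrightarrow> g z" using g that by (rule tendsto_uniform_limitI)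
    have "convergent_prod (\<lambda>k. w k z)"
      unfolding w_def using assms(1) by (rule convergent_prod_laguerre_polya)
    then show "(\<lambda>K. \<Prod>k<K. w k z) \<longlonglongrightarrow> (\<Prod>k. w k z)"
      using convergent_prod_LIMSEQ LIMSEQ_lessThan_iff_atMost by blast
  qed
  then show ?thesis using g by (subst uniform_limit_cong') auto
qed

text \<open>Uniform convergence of the partial products implies convergence of their derivatives at
  0, hence of the Taylor coefficients. All partial products are isotone with constant coefficient 1,
  so \<open>isotone_limit\<close> applies.\<close>

lemma laguerre_polya_product_expansion:
  fixes \<alpha> :: "nat \<Rightarrow> real"
  assumes "summable (\<lambda>k. (\<alpha> k)\<^sup>2)"
  defines "W \<equiv> \<lambda>z. \<Prod>k. (1 - of_real (\<alpha> k) * z) * exp (of_real (\<alpha> k) * z) :: complex"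
  obtains F where "W has_fps_expansion complex_fps F" "isotone F" "fps_nth F 0 = 1"
proof -
  define w where "w k z = (1 - of_real (\<alpha> k) * z) * exp (of_real (\<alpha> k) * z)" for k and z :: complex
  define R where "R K = (\<Prod>k<K. (1 + fps_const (- \<alpha> k) * fps_X) * fps_exp (\<alpha> k))" for K :: nat
  have lim: "uniform_limit (ball 0 1) (\<lambda>K z. \<Prod>k<K. w k z) W sequentially"
    using uniform_limit_on_subset[OF laguerre_polya_product_uniform_limit[OF assms(1)] ball_subset_cball]
    by (simp add: w_def[abs_def] W_def)
  have hol: "(\<lambda>z. \<Prod>k<K. w k z) holomorphic_on ball 0 1" for K
    unfolding w_def by (intro holomorphic_intros)
  have "W holomorphic_on ball 0 1"
  proof (rule holomorphic_uniform_sequence[OF open_ball hol])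
    fix z :: complex assume "z \<in> ball 0 1"
    then obtain d where "0 < d" "cball z d \<subseteq> ball 0 1" using open_ball open_contains_cball by metis
    then show "\<exists>d>0. cball z d \<subseteq> ball 0 1 \<and> uniform_limit (cball z d) (\<lambda>K z. \<Prod>k<K. w k z) W sequentially"
      using uniform_limit_on_subset[OF lim] by blast
  qed
  then have W: "W has_fps_expansion fps_expansion W 0" by (intro has_fps_expansion_fps_expansion) auto
  have "w k has_fps_expansion complex_fps ((1 + fps_const (- \<alpha> k) * fps_X) * fps_exp (\<alpha> k))" for k
    unfolding w_def complex_fps_mult complex_fps_one_plus complex_fps_exp
    by (rule has_fps_expansion_schematicI, (rule fps_expansion_intros)+) (simp flip: fps_const_neg)
  then have Rexp: "(\<lambda>z. \<Prod>k<K. w k z) has_fps_expansion complex_fps (R K)" for K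
    unfolding R_def by (intro has_complex_fps_prod)
  have conv: "(\<lambda>K. complex_of_real (fps_nth (R K) j)) \<longlonglongrightarrow> fps_nth (fps_expansion W 0) j" for j
  proof -
    have "(\<lambda>K. (deriv ^^ j) (\<lambda>z. \<Prod>k<K. w k z) 0) \<longlonglongrightarrow> (deriv ^^ j) W 0"
      by (rule higher_deriv_complex_uniform_limit[OF lim]) (use hol in auto)
    then have "(\<lambda>K. (deriv ^^ j) (\<lambda>z. \<Prod>k<K. w k z) 0 / fact j) \<longlonglongrightarrow> (deriv ^^ j) W 0 / fact j"
      by (intro tendsto_intros) auto
    then show ?thesis
      using fps_nth_fps_expansion[OF Rexp] fps_nth_fps_expansion[OF W] by simp
  qed
  \<comment> \<open>No information is lost in taking real parts: the coefficients of
    \<open>W\<close> are limits of the real coefficients of \<open>R K\<close>.\<close>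
  define F where "F = Abs_fps (\<lambda>j. Re (fps_nth (fps_expansion W 0) j))"
  have Fconv: "(\<lambda>K. fps_nth (R K) j) \<longlonglongrightarrow> fps_nth F j" for j
    using tendsto_Re[OF conv[of j]] by (simp add: F_def)
  have "complex_fps F = fps_expansion W 0"
    using LIMSEQ_unique[OF conv tendsto_of_real[OF Fconv]] by (intro fps_ext) simp
  moreover have R0: "fps_nth (R K) 0 = 1" for K
    unfolding R_def by (induction K) simp_all
  have F0: "fps_nth F 0 = 1" using LIMSEQ_unique[OF Fconv[of 0]] by (simp add: R0)
  moreover have "isotone F"
  proof (rule isotone_limit[OF Fconv])
    show "F \<noteq> 0" using F0 by auto
    show "isotone (R K)" for K
      unfolding R_def by (intro isotone_prod isotone_mult isotone_one_plus isotone_exp)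
    show "subdegree (R K) = subdegree F" for K using R0 F0 by simp
  qed
  ultimately show thesis using that W by metis
qed

text \<open>The constant, the power of \<open>z\<close>, the Gaussian, the exponential and the
  infinite product each have an isotone series, and so does their product.\<close>

lemma laguerre_polya_expansion:
  assumes "\<phi> \<in> laguerre_polya"
  obtains F where "\<phi> has_fps_expansion complex_fps F" "isotone F"
proof -
  obtain a b c m \<alpha> where c: "c \<noteq> 0" and \<alpha>: "summable (\<lambda>k. (\<alpha> k)\<^sup>2)"
    and \<phi>: "\<And>z. \<phi> z = of_real c * z ^ m * exp (- (of_real a)\<^sup>2 * z\<^sup>2 + of_real b * z) *
               (\<Prod>k. (1 - of_real (\<alpha> k) * z) * exp (of_real (\<alpha> k) * z))"
    using assms unfolding laguerre_polya_def by blast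
  obtain W where W: "(\<lambda>z. \<Prod>k. (1 - of_real (\<alpha> k) * z) * exp (of_real (\<alpha> k) * z)) has_fps_expansion complex_fps W"
    "isotone W"
    by (rule laguerre_polya_product_expansion[OF \<alpha>]) (rule that; assumption)
  define F where "F = fps_const c * fps_X ^ m * ((fps_exp (- a\<^sup>2) oo fps_X ^ 2) * fps_exp b) * W"
  \<comment> \<open>The Gaussian is written as an exponential composed with \<open>z ^ 2\<close>,
    matching the formal composition in \<open>isotone_gaussian\<close>.\<close>
  have gauss: "((\<lambda>z. exp (of_real (- a\<^sup>2) * z)) \<circ> (\<lambda>z. z ^ 2)) has_fps_expansion
      complex_fps (fps_exp (- a\<^sup>2) oo fps_X ^ 2)"
    unfolding complex_fps_compose_X_power complex_fps_exp
    by (intro has_fps_expansion_compose fps_expansion_intros) simp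
  have "(\<lambda>z. of_real c * z ^ m * (((\<lambda>z. exp (of_real (- a\<^sup>2) * z)) \<circ> (\<lambda>z. z ^ 2)) z * exp (of_real b * z)) *
      (\<Prod>k. (1 - of_real (\<alpha> k) * z) * exp (of_real (\<alpha> k) * z))) has_fps_expansion complex_fps F"
    unfolding F_def complex_fps_mult complex_fps_const complex_fps_X_power
    by (intro has_fps_expansion_mult has_fps_expansion_const has_fps_expansion_fps_X_power gauss W(1))
       (simp add: complex_fps_exp has_fps_expansion_exp)
  also have "(\<lambda>z. of_real c * z ^ m * (((\<lambda>z. exp (of_real (- a\<^sup>2) * z)) \<circ> (\<lambda>z. z ^ 2)) z * exp (of_real b * z)) *
      (\<Prod>k. (1 - of_real (\<alpha> k) * z) * exp (of_real (\<alpha> k) * z))) = \<phi>"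
  proof
    fix z :: complex
    have "exp (of_real (- a\<^sup>2) * z ^ 2) * exp (of_real b * z) =
        exp (- (of_real a)\<^sup>2 * z\<^sup>2 + of_real b * z)"
      by (simp add: mult_exp_exp)
    then show "of_real c * z ^ m * (((\<lambda>z. exp (of_real (- a\<^sup>2) * z)) \<circ> (\<lambda>z. z ^ 2)) z * exp (of_real b * z)) *
      (\<Prod>k. (1 - of_real (\<alpha> k) * z) * exp (of_real (\<alpha> k) * z)) = \<phi> z"
      by (simp only: comp_def \<phi>)
  qed
  finally have "\<phi> has_fps_expansion complex_fps F" .
  moreover have "isotone F"
    unfolding F_def
    by (intro isotone_mult isotone_const isotone_power isotone_X isotone_gaussian isotone_exp W(2) c)
  ultimately show thesis by (rule that)
qed

theorem corollary9:
  fixes n m :: nat and \<phi> :: "complex \<Rightarrow> complex"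
  assumes "n \<ge> m + 1"
    and "\<phi> \<in> laguerre_polya_ord m"
  shows "(\<forall>\<Phi>. schur_convex (n - m) \<Phi> \<longrightarrow>
            (\<forall>P\<in>hyperbolic_polys n. \<forall>Q\<in>hyperbolic_polys n. Q \<preceq> P \<longrightarrow>
               \<Phi> (zeros (diff_op \<phi> Q)) \<le> \<Phi> (zeros (diff_op \<phi> P)))) \<and>
         (\<forall>f::real \<Rightarrow> real. convex_on UNIV f \<longrightarrow>
            (\<forall>P\<in>hyperbolic_polys n. \<forall>Q\<in>hyperbolic_polys n. Q \<preceq> P \<longrightarrow>
               (\<Sum>i<n - m. f (zeros (diff_op \<phi> Q) ! i)) \<le>
               (\<Sum>i<n - m. f (zeros (diff_op \<phi> P) ! i))))"
proof -
  have "\<phi> \<in> laguerre_polya" and zord: "zorder \<phi> 0 = int m"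
    using assms(2) by (auto simp: laguerre_polya_ord_def)
  then obtain F where F: "\<phi> has_fps_expansion complex_fps F" "isotone F"
    using laguerre_polya_expansion by blast
  have F0: "F \<noteq> 0" using F(2) by (rule isotone_nonzero)
  \<comment> \<open>The order of the zero at 0 is the subdegree of the expansion, so
    \<open>n \<ge> m + 1\<close> supplies the degree condition in \<open>isotone\<close>.\<close>
  have sd: "subdegree F = m"
    using has_fps_expansion_zorder_0[OF F(1)] F0 zord by simp
  have "fps_expansion \<phi> 0 = complex_fps F"
    by (rule fps_ext) (subst fps_nth_fps_expansion[OF F(1)], simp add: fps_expansion_def)
  then have op: "diff_op \<phi> p = fps_op F p" for p
    by (simp add: diff_op_def fps_op_def)
  have hyp: "p \<noteq> 0" "real_rooted p" "subdegree F \<le> degree p" "degree p = n"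
    if "p \<in> hyperbolic_polys n" for p
    using that assms(1) sd by (auto simp: hyperbolic_polys_def)
  have len: "length (zeros (diff_op \<phi> p)) = n - m" if "p \<in> hyperbolic_polys n" for p
  proof -
    note h = hyp[OF that]
    have "fps_op F p \<noteq> 0 \<and> degree (fps_op F p) = n - m"
      using fps_op_degree[OF h(1) F0 h(3)] h(4) sd by simp
    moreover have "real_rooted (fps_op F p)" using F(2) h by (simp add: isotone_def)
    ultimately show ?thesis unfolding op by (simp add: length_zeros)
  qed
  \<comment> \<open>Both claims follow from this comparison together with \<open>len\<close>, since
    Schur-convexity concerns only lists of length \<open>n - m\<close>.\<close>
  have le: "zeros (diff_op \<phi> Q) \<prec> zeros (diff_op \<phi> P)"
    if "P \<in> hyperbolic_polys n" "Q \<in> hyperbolic_polys n" "Q \<preceq> P" for P Q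
  proof -
    have "convex_le (proots Q) (proots P)" using that(3) by (simp add: poly_spectral_le_iff)
    then have "convex_le (proots (fps_op F Q)) (proots (fps_op F P))"
      using F(2) hyp(1-3)[OF that(1)] hyp(1,2)[OF that(2)] by (simp add: isotone_def)
    then show ?thesis unfolding op by (simp add: spectral_le_iff mset_zeros)
  qed
  show ?thesis
  proof (intro conjI allI impI ballI)
    fix \<Phi> P Q assume "schur_convex (n - m) \<Phi>" "P \<in> hyperbolic_polys n" "Q \<in> hyperbolic_polys n" "Q \<preceq> P"
    then show "\<Phi> (zeros (diff_op \<phi> Q)) \<le> \<Phi> (zeros (diff_op \<phi> P))"
      using le len by (simp add: schur_convex_def)
  next
    fix f :: "real \<Rightarrow> real" and P Q
    assume "convex_on UNIV f" "P \<in> hyperbolic_polys n" "Q \<in> hyperbolic_polys n" "Q \<preceq> P"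
    then show "(\<Sum>i<n - m. f (zeros (diff_op \<phi> Q) ! i)) \<le> (\<Sum>i<n - m. f (zeros (diff_op \<phi> P) ! i))"
      using le[of P Q] len[of P] len[of Q] by (simp add: spectral_le_def)
  qed
qed

end
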